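(* Let $(P_0,f_0)\in\mathcal{R}$ and $V\in(T\mathcal{R})_{(P_0,f_0)}$ with $|V|_{(P_0,f_0)}=1$. Let $X_0$ be a minimal lifting of $V$. Then the curve $$\delta(t)=e^{tX_0}\cdot(P_0,f_0)=(e^{tX_0}P_0e^{-tX_0},e^{tX_0}f_0)$$ has minimal length along its path for $|t|\le\pi/2$: for every $t$ with $|t|\le\pi/2$, the arc of $\delta$ between the parameters $0$ and $t$ has length less than or equal to that of any piecewise smooth curve in $\mathcal{R}$ joining $\delta(0)=(P_0,f_0)$ and $\delta(t)$.
   Context: $\mathcal{H}$ is a complex Hilbert space, $\mathcal{B}_{ah}(\mathcal{H})$ the anti-Hermitian bounded operators with the operator norm, $\mathcal{R}=\{(P,f): P \text{ an orthogonal projection on } \mathcal{H},\ f\in\mathcal{H},\ Pf=f,\ \|f\|=1\}$, a smooth submanifold of $\mathcal{B}(\mathcal{H})\times\mathcal{H}$ on which the unitary group acts by $U\cdot(P,f)=(UPU^*,Uf)$. For $(P,f)\in\mathcal{R}$ the tangent space is $(T\mathcal{R})_{(P,f)}=\{(XP-PX,Xf): X\in\mathcal{B}_{ah}(\mathcal{H})\}$ and $\delta_{(P,f)}(X)=(XP-PX,Xf)$. The (Finsler) quotient norm on $(T\mathcal{R})_{(P,f)}$ is $|V|_{(P,f)}=\inf\{\|X\|: X\in\mathcal{B}_{ah}(\mathcal{H}),\ \delta_{(P,f)}(X)=V\}$. A lifting of $V$ is an $X\in\mathcal{B}_{ah}(\mathcal{H})$ with $\delta_{(P,f)}(X)=V$,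 and it is minimal if $\|X\|=|V|_{(P,f)}$. The length of a piecewise smooth curve $\gamma:[a,b]\to\mathcal{R}$ is $L(\gamma)=\int_a^b|\dot\gamma(t)|_{\gamma(t)}\,dt$. *)

theory Defs
  imports "HOL-Analysis.Analysis"
begin

text \<open>
  A complex Hilbert space is a complete real inner product space that also carries a complex
  scalar multiplication and a complex inner product \<^term>\<open>cinner\<close>, linear in the first argument,
  whose real part is the real inner product. So \<open>norm x = sqrt (Re (cinner x x))\<close>, and
  positive definiteness of \<open>cinner\<close> is that of \<open>inner\<close>.
\<close>

class complex_hilbert = real_inner + complete_space +
  fixes scaleC :: "complex \<Rightarrow> 'a \<Rightarrow> 'a" (infixr "*\<^sub>C" 75)
    and cinner :: "'a \<Rightarrow> 'a \<Rightarrow> complex"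
  assumes scaleC_add_right: "c *\<^sub>C (x + y) = c *\<^sub>C x + c *\<^sub>C y"
    and scaleC_add_left: "(c + d) *\<^sub>C x = c *\<^sub>C x + d *\<^sub>C x"
    and scaleC_scaleC: "c *\<^sub>C d *\<^sub>C x = (c * d) *\<^sub>C x"
    and scaleC_of_real: "complex_of_real r *\<^sub>C x = r *\<^sub>R x"
    and cinner_commute: "cinner x y = cnj (cinner y x)"
    and cinner_add_left: "cinner (x + y) z = cinner x z + cinner y z"
    and cinner_scaleC_left: "cinner (c *\<^sub>C x) y = c * cinner x y"
    and Re_cinner: "Re (cinner x y) = inner x y"
begin

subclass banach ..

end

text \<open>
  The type \<open>'a \<Rightarrow>\<^sub>L 'a\<close> consists of the bounded real-linear maps; the bounded operators on the
  complex space are those that are complex-linear. Its norm is the operator norm in both cases.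
\<close>

definition bounded_ops :: "('a::complex_hilbert \<Rightarrow>\<^sub>L 'a) set" where
  "bounded_ops = {A. \<forall>c x. blinfun_apply A (c *\<^sub>C x) = c *\<^sub>C blinfun_apply A x}"

definition antihermitian_ops :: "('a::complex_hilbert \<Rightarrow>\<^sub>L 'a) set" where
  "antihermitian_ops =
    {X \<in> bounded_ops. \<forall>x y. cinner (blinfun_apply X x) y = - cinner x (blinfun_apply X y)}"

definition orthogonal_projections :: "('a::complex_hilbert \<Rightarrow>\<^sub>L 'a) set" where
  "orthogonal_projections =
    {P \<in> bounded_ops. P o\<^sub>L P = P \<and>
      (\<forall>x y. cinner (blinfun_apply P x) y = cinner x (blinfun_apply P y))}"

text \<open>
  The exponential series, convergent in operator norm. The library's \<^term>\<open>exp\<close> is not available,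
  since \<open>'a \<Rightarrow>\<^sub>L 'a\<close> is not an instance of \<^class>\<open>real_normed_algebra_1\<close>.
\<close>

definition op_exp :: "('a::complex_hilbert \<Rightarrow>\<^sub>L 'a) \<Rightarrow> 'a \<Rightarrow>\<^sub>L 'a" where
  "op_exp X = (\<Sum>n. (1 / fact n) *\<^sub>R (((o\<^sub>L) X) ^^ n) id_blinfun)"

definition R_space :: "(('a::complex_hilbert \<Rightarrow>\<^sub>L 'a) \<times> 'a) set" where
  "R_space = {(P, f). P \<in> orthogonal_projections \<and> blinfun_apply P f = f \<and> norm f = 1}"

fun delta_map ::
  "('a::complex_hilbert \<Rightarrow>\<^sub>L 'a) \<times> 'a \<Rightarrow> ('a \<Rightarrow>\<^sub>L 'a) \<Rightarrow> ('a \<Rightarrow>\<^sub>L 'a) \<times> 'a" where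
  "delta_map (P, f) X = ((X o\<^sub>L P) - (P o\<^sub>L X), blinfun_apply X f)"

definition tangent_space ::
  "('a::complex_hilbert \<Rightarrow>\<^sub>L 'a) \<times> 'a \<Rightarrow> (('a \<Rightarrow>\<^sub>L 'a) \<times> 'a) set" where
  "tangent_space p = delta_map p ` antihermitian_ops"

definition liftings ::
  "('a::complex_hilbert \<Rightarrow>\<^sub>L 'a) \<times> 'a \<Rightarrow> ('a \<Rightarrow>\<^sub>L 'a) \<times> 'a \<Rightarrow> ('a \<Rightarrow>\<^sub>L 'a) set" where
  "liftings p V = {X \<in> antihermitian_ops. delta_map p X = V}"

text \<open>The value is only meaningful for \<open>V \<in> tangent_space p\<close>, where the infimum is over a
  nonempty set.\<close>

definition quotient_norm ::
  "('a::complex_hilbert \<Rightarrow>\<^sub>L 'a) \<times> 'a \<Rightarrow> ('a \<Rightarrow>\<^sub>L 'a) \<times> 'a \<Rightarrow> real" where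
  "quotient_norm p V = (INF X \<in> liftings p V. norm X)"

definition minimal_lifting ::
  "('a::complex_hilbert \<Rightarrow>\<^sub>L 'a) \<times> 'a \<Rightarrow> ('a \<Rightarrow>\<^sub>L 'a) \<times> 'a \<Rightarrow> ('a \<Rightarrow>\<^sub>L 'a) \<Rightarrow> bool" where
  "minimal_lifting p V X \<longleftrightarrow> X \<in> liftings p V \<and> norm X = quotient_norm p V"

text \<open>\<open>D n\<close> is the \<open>n\<close>-th derivative on \<open>{c..d}\<close>, one-sided at the end points.\<close>

definition smooth_on_interval :: "real \<Rightarrow> real \<Rightarrow> (real \<Rightarrow> 'b::real_normed_vector) \<Rightarrow> bool" where
  "smooth_on_interval c d g \<longleftrightarrow>
    (\<exists>D :: nat \<Rightarrow> real \<Rightarrow> 'b. D 0 = g \<and>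
      (\<forall>n. \<forall>t\<in>{c..d}. (D n has_vector_derivative D (Suc n) t) (at t within {c..d})))"

text \<open>
  Smoothness is required on the closed pieces of a partition of \<open>{a..b}\<close>; in particular the
  curve is continuous and its speed is bounded. The library's
  \<^const>\<open>piecewise_C1_differentiable_on\<close> does not control the derivative near the break points.
\<close>

definition piecewise_smooth :: "real \<Rightarrow> real \<Rightarrow> (real \<Rightarrow> 'b::real_normed_vector) \<Rightarrow> bool" where
  "piecewise_smooth a b g \<longleftrightarrow>
    (\<exists>(k::nat) p. p 0 = a \<and> p k = b \<and>
      (\<forall>i<k. p i < p (Suc i) \<and> smooth_on_interval (p i) (p (Suc i)) g))"

text \<open>At the finitely many break points the derivative may fail to exist; its value there is
  irrelevant to the integral.\<close>

definition curve_length ::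
  "real \<Rightarrow> real \<Rightarrow> (real \<Rightarrow> ('a::complex_hilbert \<Rightarrow>\<^sub>L 'a) \<times> 'a) \<Rightarrow> real" where
  "curve_length a b g =
    integral {a..b} (\<lambda>t. quotient_norm (g t) (vector_derivative g (at t within {a..b})))"

definition exp_curve ::
  "('a::complex_hilbert \<Rightarrow>\<^sub>L 'a) \<Rightarrow> ('a \<Rightarrow>\<^sub>L 'a) \<times> 'a \<Rightarrow> real \<Rightarrow> ('a \<Rightarrow>\<^sub>L 'a) \<times> 'a" where
  "exp_curve X p t =
    (op_exp (t *\<^sub>R X) o\<^sub>L fst p o\<^sub>L op_exp (- t *\<^sub>R X), blinfun_apply (op_exp (t *\<^sub>R X)) (snd p))"

end

theory Submission
  imports Defs
begin

text \<open>
  Up to an arbitrarily small error, a curve of length \<open>L\<close> in the space of pairs is followed by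
  unitaries: between nearby parameters use the exponential of a nearly minimal lifting of the
  velocity, and multiply these up. Such an exponential turns every unit vector by an angle of at most
  (essentially) the length of the step, and angles on the unit sphere obey the triangle inequality.
  So the product \<open>U\<close> almost carries the initial point to the end point, and no unit vector is turned
  by more than \<open>L\<close> (lemma \<open>joined_upto_curve_length\<close>).

  It remains to see that a unitary \<open>U\<close> which carries \<open>p = (P, f)\<close> to \<open>e\<^sup>t\<^sup>X \<cdot> p\<close>, where \<open>X\<close> is the minimal
  lifting, must turn some vector by \<open>|t|\<close> (lemma \<open>joined_upto_exp_curve_bound\<close>). The
  unitary \<open>v = U\<^sup>-\<^sup>1 e\<^sup>t\<^sup>X\<close> fixes \<open>p\<close>, so \<open>A = (v - v\<^sup>-\<^sup>1) / 2\<close> is anti-Hermitian and is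
  annihilated by the map \<open>\<delta>\<close> at \<open>p\<close>. Hence \<open>X + \<tau> A\<close> lifts the same vector as \<open>X\<close>, and its norm is at
  least \<open>1 = \<parallel>X\<parallel>\<close> for all small \<open>\<tau>\<close> of either sign. Looking at the first order in \<open>\<tau>\<close>, one finds a
  unit vector \<open>x\<close> with \<open>X\<^sup>2 x \<approx> - x\<close> at which the real number \<open>\<langle>X x, A x\<rangle>\<close> has, up to a small error,
  whichever sign is wanted (lemma \<open>minimal_lifting_almost_norming\<close>). On the plane of \<open>x\<close> and \<open>X x\<close>
  the group \<open>e\<^sup>t\<^sup>X\<close> is nearly the rotation by \<open>t\<close>, and with \<open>U\<^sup>-\<^sup>1 = v e\<^sup>-\<^sup>t\<^sup>X\<close> this gives, for
  real inner products,
  \<open>\<langle>U\<^sup>-\<^sup>1 x, x\<rangle> + \<langle>U\<^sup>-\<^sup>1 X x, X x\<rangle> \<approx> cos t (\<langle>v x, x\<rangle> + \<langle>v X x, X x\<rangle>) + 2 sin t \<langle>X x, A x\<rangle>\<close>.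
  Both vectors are needed because the Hermitian part of \<open>v\<close> drops out of the second term only in the
  sum. Choosing the sign, and using \<open>cos t \<ge> 0\<close> for \<open>|t| \<le> \<pi>/2\<close>, the right-hand side is at most about
  \<open>2 cos t\<close>; if \<open>U\<close> turns no vector by more than \<open>L\<close>, the left-hand side is at least about \<open>2 cos L\<close>.
  So \<open>L \<ge> |t|\<close>.

  Only an approximate \<open>U\<close> is at hand, so \<open>A\<close> lies near the isotropy algebra rather than in it. An
  explicit lifting, with norm bounded by the norm of the lifted vector (lemma \<open>tangent_vector_lift\<close>),
  provides the correction. The same lifting shows that velocities of curves are tangent and that the
  quotient norm depends continuously on the point and the vector, so that the speed of a
  smooth curve is integrable. Finally, the curve in question has length at most \<open>|t|\<close>, since \<open>X\<close> lifts its velocity at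
  every parameter.
\<close>

section \<open>The operator exponential\<close>

interpretation op_compose: bounded_bilinear "(o\<^sub>L)"
  by (rule bounded_bilinear_blinfun_compose)

lemma blinfun_eq_iff: "A = B \<longleftrightarrow> (\<forall>x. blinfun_apply A x = blinfun_apply B x)"
  by (auto intro: blinfun_eqI)

lemma blinfun_compose_assoc: "(A o\<^sub>L B) o\<^sub>L C = A o\<^sub>L (B o\<^sub>L C)"
  by (simp add: blinfun_eq_iff)

abbreviation op_power :: "('a::complex_hilbert \<Rightarrow>\<^sub>L 'a) \<Rightarrow> nat \<Rightarrow> 'a \<Rightarrow>\<^sub>L 'a" where
  "op_power X n \<equiv> (((o\<^sub>L) X) ^^ n) id_blinfun"

lemma op_power_scaleR: "op_power (t *\<^sub>R X) n = t ^ n *\<^sub>R op_power X n"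
  by (induction n) (auto intro!: blinfun_eqI simp: blinfun.bilinear_simps)

lemma op_power_commute: "op_power X n o\<^sub>L X = X o\<^sub>L op_power X n"
  by (induction n) (auto intro!: blinfun_eqI simp: blinfun_eq_iff)

lemma norm_op_power_le: "norm (op_power X n) \<le> norm X ^ n"
proof (induction n)
  case 0
  show ?case by (simp add: norm_blinfun_bound)
next
  case (Suc n)
  have "norm (op_power X (Suc n)) \<le> norm X * norm (op_power X n)"
    by (simp add: norm_blinfun_compose)
  also have "\<dots> \<le> norm X * norm X ^ n"
    by (intro mult_left_mono Suc.IH) auto
  finally show ?case by simp
qed

lemma summable_op_exp_norm: "summable (\<lambda>n. norm X ^ n / fact n :: real)"
  using summable_exp[of "norm X"] by (simp add: field_simps)

lemma norm_op_exp_term_le: "norm ((1 / fact n) *\<^sub>R op_power X n) \<le> norm X ^ n / fact n"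
  using norm_op_power_le[of n X] by (simp add: divide_simps)

lemma op_exp_sums: "(\<lambda>n. (1 / fact n) *\<^sub>R op_power X n) sums op_exp X"
  unfolding op_exp_def
  by (intro summable_sums summable_comparison_test'[OF summable_op_exp_norm[of X]])
    (use norm_op_exp_term_le in auto)

lemma op_exp_apply_sums: "(\<lambda>n. (1 / fact n) *\<^sub>R blinfun_apply (op_power X n) x) sums blinfun_apply (op_exp X) x"
  using bounded_linear.sums[OF blinfun.bounded_linear_left[of x] op_exp_sums[of X]]
  by (simp add: blinfun.scaleR_left)

lemma op_exp_0 [simp]: "op_exp 0 = id_blinfun"
proof -
  have "op_power (0::'a \<Rightarrow>\<^sub>L 'a) (Suc n) = 0" for n
    by (auto intro!: blinfun_eqI)
  then have eq: "(1 / fact n) *\<^sub>R op_power (0::'a \<Rightarrow>\<^sub>L 'a) n = (if n = 0 then id_blinfun else 0)" for n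
    by (cases n) auto
  show ?thesis
    using op_exp_sums[of "0 :: 'a \<Rightarrow>\<^sub>L 'a"] sums_single[of 0 "\<lambda>_. id_blinfun :: 'a \<Rightarrow>\<^sub>L 'a"]
    unfolding eq by (metis (no_types, lifting) ext sums_unique2)
qed

lemma op_exp_commute: "op_exp (t *\<^sub>R X) o\<^sub>L X = X o\<^sub>L op_exp (t *\<^sub>R X)"
proof -
  have "(\<lambda>n. ((1 / fact n) *\<^sub>R op_power (t *\<^sub>R X) n) o\<^sub>L X) sums (op_exp (t *\<^sub>R X) o\<^sub>L X)"
    by (rule bounded_linear.sums[OF _ op_exp_sums]) (rule op_compose.bounded_linear_left)
  moreover have "(\<lambda>n. X o\<^sub>L ((1 / fact n) *\<^sub>R op_power (t *\<^sub>R X) n)) sums (X o\<^sub>L op_exp (t *\<^sub>R X))"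
    by (rule bounded_linear.sums[OF _ op_exp_sums]) (rule op_compose.bounded_linear_right)
  moreover have "((1 / fact n) *\<^sub>R op_power (t *\<^sub>R X) n) o\<^sub>L X = X o\<^sub>L ((1 / fact n) *\<^sub>R op_power (t *\<^sub>R X) n)" for n
    using op_power_commute[of n X]
    by (auto simp: op_power_scaleR blinfun_eq_iff blinfun.bilinear_simps)
  ultimately show ?thesis
    by (metis (no_types, lifting) ext sums_unique2)
qed

text \<open>
  The power series is differentiated term by term; shifting the index turns the differentiated
  series back into \<open>X\<close> times the original one, so its uniform convergence on balls needs no separate
  estimate.
\<close>
lemma op_exp_has_vector_derivative:
  "((\<lambda>t. op_exp (t *\<^sub>R X)) has_vector_derivative (X o\<^sub>L op_exp (t *\<^sub>R X))) (at t within S)"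
proof -
  define r where "r = \<bar>t\<bar> + 1"
  \<comment> \<open>an open ball around \<open>t\<close>, so that the derivative within it is the full derivative\<close>
  define B where "B = ball (0::real) r"
  define f where "f n s = (s ^ n / fact n) *\<^sub>R op_power X n" for n and s :: real
  define d where "d n s = (of_nat n * s ^ (n - 1) / fact n) *\<^sub>R op_power X n" for n and s :: real
  have op: "op_exp (s *\<^sub>R X) = (\<Sum>n. f n s)" and fs: "(\<lambda>n. f n s) sums op_exp (s *\<^sub>R X)" for s
    using op_exp_sums[of "s *\<^sub>R X"] by (simp_all add: op_power_scaleR f_def sums_iff)
  have dS: "d (Suc n) s = X o\<^sub>L f n s" for n s
  proof -
    have "real (Suc n) * s ^ n / fact (Suc n) = s ^ n / fact n"
      by (simp only: fact_Suc of_nat_mult) (simp del: of_nat_Suc)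
    then show ?thesis by (simp add: d_def f_def op_compose.scaleR_right)
  qed
  have lim: "uniform_limit B (\<lambda>n s. \<Sum>i<n. f i s) (\<lambda>s. \<Sum>i. f i s) sequentially"
  proof (rule Weierstrass_m_test)
    show "summable (\<lambda>n. (r * norm X) ^ n / fact n)"
      using summable_exp[of "r * norm X"] by (simp add: field_simps)
    fix n s assume "s \<in> B"
    then have s: "\<bar>s\<bar> \<le> r" by (simp add: B_def)
    have "norm (f n s) = \<bar>s\<bar> ^ n / fact n * norm (op_power X n)"
      by (simp add: f_def power_abs)
    also have "\<dots> \<le> r ^ n / fact n * norm X ^ n"
      by (intro mult_mono divide_right_mono power_mono s norm_op_power_le) (auto simp: r_def)
    finally show "norm (f n s) \<le> (r * norm X) ^ n / fact n"
      by (simp add: power_mult_distrib)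
  qed
  have deriv: "(f n has_derivative (\<lambda>h. h *\<^sub>R d n s)) (at s within B)" for n s
    unfolding f_def d_def
    by (rule has_derivative_eq_rhs, (rule derivative_intros)+) (auto simp: scaleR_scaleR algebra_simps)
  have "\<exists>g. \<forall>x\<in>B. (\<lambda>n. f n x) sums g x \<and>
          (g has_derivative (\<lambda>h. h *\<^sub>R (X o\<^sub>L op_exp (x *\<^sub>R X)))) (at x within B)"
  proof (rule has_derivative_series[where f' = "\<lambda>n s h. h *\<^sub>R d n s", OF _ deriv])
    show "convex B" "t \<in> B" by (auto simp: B_def r_def)
    show "(\<lambda>n. f n t) sums op_exp (t *\<^sub>R X)" by (rule fs)
    fix e :: real assume "e > 0"
    then have e': "e / (norm X + 1) > 0"
      by (intro divide_pos_pos) (auto intro: add_nonneg_pos)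
    have "\<forall>\<^sub>F n in sequentially. \<forall>s\<in>B. norm ((\<Sum>i<n. f i s) - op_exp (s *\<^sub>R X)) < e / (norm X + 1)"
      using uniform_limitD[OF lim e'] by (simp add: op dist_norm)
    \<comment> \<open>the differentiated partial sums lag one term behind\<close>
    then have ev: "\<forall>\<^sub>F n in sequentially. \<forall>s\<in>B. norm ((\<Sum>i<n - 1. f i s) - op_exp (s *\<^sub>R X)) < e / (norm X + 1)"
      by (rule eventually_compose_filterlim[where F = sequentially, OF _ filterlim_minus_const_nat_at_top])
    show "\<forall>\<^sub>F n in sequentially. \<forall>x\<in>B. \<forall>h.
        norm ((\<Sum>i<n. h *\<^sub>R d i x) - h *\<^sub>R (X o\<^sub>L op_exp (x *\<^sub>R X))) \<le> e * norm h"
      using ev eventually_gt_at_top[of 0]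
    proof eventually_elim
      case (elim n)
      then obtain m where m: "n = Suc m" by (cases n) auto
      show ?case
      proof (intro ballI allI)
        fix s h :: real assume "s \<in> B"
        have "(\<Sum>i<n. d i s) = X o\<^sub>L (\<Sum>i<m. f i s)"
          unfolding m sum.lessThan_Suc_shift
          by (simp add: dS op_compose.sum_right) (simp add: d_def)
        then have eq: "(\<Sum>i<n. h *\<^sub>R d i s) - h *\<^sub>R (X o\<^sub>L op_exp (s *\<^sub>R X))
            = h *\<^sub>R (X o\<^sub>L ((\<Sum>i<m. f i s) - op_exp (s *\<^sub>R X)))"
          by (simp add: scaleR_sum_right[symmetric] scaleR_diff_right op_compose.diff_right)
        have "norm (X o\<^sub>L ((\<Sum>i<m. f i s) - op_exp (s *\<^sub>R X))) \<le> norm X * (e / (norm X + 1))"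
          using elim \<open>s \<in> B\<close> m
          by (intro order_trans[OF norm_blinfun_compose] mult_left_mono) (auto simp: less_imp_le)
        also have "\<dots> \<le> e"
          using \<open>e > 0\<close> by (simp add: pos_divide_le_eq add_nonneg_pos mult.commute mult_left_mono)
        finally show "norm ((\<Sum>i<n. h *\<^sub>R d i s) - h *\<^sub>R (X o\<^sub>L op_exp (s *\<^sub>R X))) \<le> e * norm h"
          unfolding eq norm_scaleR by (subst mult.commute) (auto intro: mult_right_mono)
      qed
    qed
  qed
  then obtain g where g: "\<And>x. x \<in> B \<Longrightarrow> (\<lambda>n. f n x) sums g x"
    "\<And>x. x \<in> B \<Longrightarrow> (g has_derivative (\<lambda>h. h *\<^sub>R (X o\<^sub>L op_exp (x *\<^sub>R X)))) (at x within B)"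
    by blast
  have tB: "t \<in> B" and oB: "open B" by (auto simp: B_def r_def)
  have geq: "g x = op_exp (x *\<^sub>R X)" if "x \<in> B" for x
    using sums_unique2[OF g(1)[OF that] fs] .
  have "(g has_derivative (\<lambda>h. h *\<^sub>R (X o\<^sub>L op_exp (t *\<^sub>R X)))) (at t)"
    using g(2)[OF tB] at_within_open[OF tB oB] by simp
  then have "((\<lambda>t. op_exp (t *\<^sub>R X)) has_derivative (\<lambda>h. h *\<^sub>R (X o\<^sub>L op_exp (t *\<^sub>R X)))) (at t)"
    by (rule has_derivative_transform_within_open[OF _ oB tB]) (simp add: geq)
  then show ?thesis
    unfolding has_vector_derivative_def by (rule has_derivative_at_withinI)
qed

lemma op_exp_minus_has_vector_derivative:
  "((\<lambda>t. op_exp (- t *\<^sub>R X)) has_vector_derivative - (X o\<^sub>L op_exp (- t *\<^sub>R X))) (at t within S)"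
  using op_exp_has_vector_derivative[of "- X" t S]
  by (simp add: op_compose.minus_left)

text \<open>
  The product has derivative zero, because \<open>X\<close> commutes with its exponentials.
\<close>
lemma op_exp_minus_cancel: "op_exp (- t *\<^sub>R X) o\<^sub>L op_exp (t *\<^sub>R X) = id_blinfun"
proof -
  define G where "G s = op_exp (- s *\<^sub>R X) o\<^sub>L op_exp (s *\<^sub>R X)" for s
  have "(G has_vector_derivative 0) (at s within UNIV)" for s
  proof -
    have "(op_exp (- s *\<^sub>R X) o\<^sub>L (X o\<^sub>L op_exp (s *\<^sub>R X))) + (- (X o\<^sub>L op_exp (- s *\<^sub>R X)) o\<^sub>L op_exp (s *\<^sub>R X)) = 0"
      using arg_cong[OF op_exp_commute[of "- s" X], of "\<lambda>A. A o\<^sub>L op_exp (s *\<^sub>R X)"]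
      by (simp add: op_compose.minus_left blinfun_compose_assoc)
    then show ?thesis
      unfolding G_def
      using op_compose.has_vector_derivative[OF
        op_exp_minus_has_vector_derivative[of X s UNIV] op_exp_has_vector_derivative[of X s UNIV]]
      by simp
  qed
  then obtain c where "\<And>s. G s = c"
    using has_derivative_zero_constant[of UNIV G] by (auto simp: has_vector_derivative_def)
  then have "G t = G 0" by simp
  then show ?thesis by (simp add: G_def blinfun_eq_iff)
qed

section \<open>Complex inner products and anti-Hermitian operators\<close>

lemma cinner_add_right: "cinner x (y + z) = cinner x y + cinner x z"
  by (metis cinner_add_left cinner_commute complex_cnj_add)

lemma cinner_scaleC_right: "cinner x (c *\<^sub>C y) = cnj c * cinner x y"
  by (metis cinner_commute cinner_scaleC_left complex_cnj_mult)

lemma cinner_scaleR_left: "cinner (r *\<^sub>R x) y = of_real r * cinner x y"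
  by (metis cinner_scaleC_left scaleC_of_real)

lemma scaleC_zero_right [simp]: "c *\<^sub>C 0 = 0"
  by (metis add_cancel_right_right scaleC_add_right)

lemma scaleC_minus_right: "c *\<^sub>C (- x) = - (c *\<^sub>C x)"
  by (metis add.right_inverse add_eq_0_iff scaleC_add_right scaleC_zero_right)

lemma scaleC_diff_right: "c *\<^sub>C (x - y) = c *\<^sub>C x - c *\<^sub>C y"
  using scaleC_add_right[of c x "- y"] by (simp add: scaleC_minus_right)

lemma scaleC_scaleR: "c *\<^sub>C (r *\<^sub>R x) = r *\<^sub>R (c *\<^sub>C x)"
  by (metis scaleC_of_real scaleC_scaleC mult.commute)

lemma norm_scaleC: "norm (c *\<^sub>C x) = cmod c * norm x"
proof -
  have "cnj c * (c * cinner x x) = of_real ((cmod c)\<^sup>2) * cinner x x"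
    by (metis complex_norm_square mult.assoc mult.commute)
  then have "cinner (c *\<^sub>C x) (c *\<^sub>C x) = of_real ((cmod c)\<^sup>2) * cinner x x"
    by (simp only: cinner_scaleC_left cinner_scaleC_right)
  from arg_cong[OF this, of Re] have "inner (c *\<^sub>C x) (c *\<^sub>C x) = (cmod c)\<^sup>2 * inner x x"
    by (simp only: times_complex.sel Re_complex_of_real Im_complex_of_real Re_cinner mult_zero_left diff_zero)
  then show ?thesis
    by (simp add: norm_eq_sqrt_inner real_sqrt_mult)
qed

lemma bounded_linear_scaleC: "bounded_linear ((*\<^sub>C) c)"
  by (rule bounded_linear_intro[where K = "cmod c"])
    (auto simp: scaleC_add_right scaleC_scaleR norm_scaleC)

lemma norm_cinner_le: "cmod (cinner x y) \<le> norm x * norm y"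
proof (cases "cinner x y = 0")
  case False
  define c where "c = cnj (cinner x y) / cmod (cinner x y)"
  have "c * cinner x y = cmod (cinner x y)"
    using False by (simp add: c_def complex_norm_square[symmetric] power2_eq_square mult.commute)
  then have "cmod (cinner x y) = inner (c *\<^sub>C x) y"
    by (metis Re_cinner Re_complex_of_real cinner_scaleC_left)
  also have "\<dots> \<le> norm (c *\<^sub>C x) * norm y"
    by (rule norm_cauchy_schwarz)
  also have "\<dots> = norm x * norm y"
    using False by (simp add: norm_scaleC c_def norm_divide)
  finally show ?thesis .
qed simp

lemma Im_cinner: "Im (cinner x y) = inner x (\<i> *\<^sub>C y)"
  by (simp add: Re_cinner[symmetric] cinner_scaleC_right)

lemma cinner_self: "cinner x x = of_real ((norm x)\<^sup>2)"
proof (rule complex_eqI)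
  show "Im (cinner x x) = Im (of_real ((norm x)\<^sup>2))"
    using arg_cong[OF cinner_commute[of x x], of Im] by simp
qed (simp add: Re_cinner power2_norm_eq_inner)

lemma bounded_opsD: "A \<in> bounded_ops \<Longrightarrow> blinfun_apply A (c *\<^sub>C x) = c *\<^sub>C blinfun_apply A x"
  by (simp add: bounded_ops_def)

lemma bounded_ops_closed [intro]:
  "id_blinfun \<in> bounded_ops"
  "A \<in> bounded_ops \<Longrightarrow> B \<in> bounded_ops \<Longrightarrow> A o\<^sub>L B \<in> bounded_ops"
  "A \<in> bounded_ops \<Longrightarrow> B \<in> bounded_ops \<Longrightarrow> A + B \<in> bounded_ops"
  "A \<in> bounded_ops \<Longrightarrow> B \<in> bounded_ops \<Longrightarrow> A - B \<in> bounded_ops"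
  "A \<in> bounded_ops \<Longrightarrow> - A \<in> bounded_ops"
  "A \<in> bounded_ops \<Longrightarrow> r *\<^sub>R A \<in> bounded_ops"
  by (simp_all add: bounded_ops_def blinfun.bilinear_simps scaleC_add_right scaleC_diff_right
      scaleC_minus_right scaleC_scaleR)

text \<open>
  For complex-linear maps, adjointness may be tested on the real inner product: the imaginary part of
  \<^term>\<open>cinner\<close> is the real inner product with \<open>\<i>\<close> times the second argument. So the
  conditions defining projections and anti-Hermitian operators can be checked, and used, in the
  underlying real Hilbert space.
\<close>
lemma cinner_adjoint_iff:
  assumes "B \<in> bounded_ops"
  shows "(\<forall>x y. cinner (blinfun_apply A x) y = cinner x (blinfun_apply B y)) \<longleftrightarrow>
    (\<forall>x y. inner (blinfun_apply A x) y = inner x (blinfun_apply B y))"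
proof
  assume "\<forall>x y. cinner (blinfun_apply A x) y = cinner x (blinfun_apply B y)"
  then show "\<forall>x y. inner (blinfun_apply A x) y = inner x (blinfun_apply B y)"
    by (metis Re_cinner)
next
  assume "\<forall>x y. inner (blinfun_apply A x) y = inner x (blinfun_apply B y)"
  then show "\<forall>x y. cinner (blinfun_apply A x) y = cinner x (blinfun_apply B y)"
    by (auto intro!: complex_eqI simp: Re_cinner Im_cinner bounded_opsD[OF assms, symmetric])
qed

lemma antihermitian_ops_iff:
  "X \<in> antihermitian_ops \<longleftrightarrow>
    X \<in> bounded_ops \<and> (\<forall>x y. inner (blinfun_apply X x) y = - inner x (blinfun_apply X y))"
proof -
  have minus: "- cinner x y = cinner x (- y)" for x y :: 'a
    by (metis add.right_inverse add_eq_0_iff cinner_add_right add_cancel_right_right)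
  have "(\<forall>x y. cinner (blinfun_apply X x) y = cinner x (blinfun_apply (- X) y)) \<longleftrightarrow>
    (\<forall>x y. inner (blinfun_apply X x) y = inner x (blinfun_apply (- X) y))" if "X \<in> bounded_ops"
    using that by (intro cinner_adjoint_iff) auto
  then show ?thesis
    by (auto simp: antihermitian_ops_def minus blinfun.minus_left)
qed

lemma orthogonal_projections_iff:
  "P \<in> orthogonal_projections \<longleftrightarrow> P \<in> bounded_ops \<and> P o\<^sub>L P = P \<and>
    (\<forall>x y. inner (blinfun_apply P x) y = inner x (blinfun_apply P y))"
  using cinner_adjoint_iff[of P P] by (auto simp: orthogonal_projections_def)

lemma antihermitian_ops_closed [intro]:
  "A \<in> antihermitian_ops \<Longrightarrow> B \<in> antihermitian_ops \<Longrightarrow> A + B \<in> antihermitian_ops"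
  "A \<in> antihermitian_ops \<Longrightarrow> B \<in> antihermitian_ops \<Longrightarrow> A - B \<in> antihermitian_ops"
  "A \<in> antihermitian_ops \<Longrightarrow> r *\<^sub>R A \<in> antihermitian_ops"
  by (auto simp: antihermitian_ops_iff blinfun.bilinear_simps inner_simps)

lemma antihermitian_inner_self: "X \<in> antihermitian_ops \<Longrightarrow> inner (blinfun_apply X x) x = 0"
  unfolding antihermitian_ops_iff by (metis eq_neg_iff_add_eq_0 inner_commute mult_2 mult_eq_0_iff zero_neq_numeral)

lemma norm_orthogonal_projection_le:
  assumes "P \<in> orthogonal_projections"
  shows "norm P \<le> 1"
proof (rule norm_blinfun_bound)
  fix x
  have "(norm (blinfun_apply P x))\<^sup>2 = inner (blinfun_apply P x) x"
    using assms unfolding orthogonal_projections_iff power2_norm_eq_inner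
    by (metis blinfun_apply_blinfun_compose)
  also have "\<dots> \<le> norm (blinfun_apply P x) * norm x"
    by (rule norm_cauchy_schwarz)
  finally show "norm (blinfun_apply P x) \<le> 1 * norm x"
    by (cases "norm (blinfun_apply P x) = 0") (auto simp: power2_eq_square)
qed simp

text \<open>
  If \<open>f\<close> is a unit vector and \<open>g\<close> is orthogonal to it for the real inner product, this is an
  anti-Hermitian operator of rank at most two sending \<open>f\<close> to \<open>g\<close>. The last summand removes the part
  of \<open>g\<close> along \<open>\<i> f\<close>, which the first two count twice.
\<close>
definition rank_two_lift :: "'a::complex_hilbert \<Rightarrow> 'a \<Rightarrow> 'a \<Rightarrow>\<^sub>L 'a" where
  "rank_two_lift f g = Blinfun (\<lambda>h. cinner h f *\<^sub>C g - cinner h g *\<^sub>C f - (cinner g f * cinner h f) *\<^sub>C f)"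

lemma rank_two_lift_apply:
  "blinfun_apply (rank_two_lift f g) h = cinner h f *\<^sub>C g - cinner h g *\<^sub>C f - (cinner g f * cinner h f) *\<^sub>C f"
  and norm_rank_two_lift_le: "norm f = 1 \<Longrightarrow> norm (rank_two_lift f g) \<le> 3 * norm g"
proof -
  let ?F = "\<lambda>h. cinner h f *\<^sub>C g - cinner h g *\<^sub>C f - (cinner g f * cinner h f) *\<^sub>C f"
  let ?K = "norm f * norm g + norm g * norm f + norm g * norm f * norm f * norm f"
  have bound: "norm (?F h) \<le> norm h * ?K" for h
  proof -
    have "norm (cinner h f *\<^sub>C g) \<le> norm h * norm f * norm g"
      by (simp add: norm_scaleC norm_cinner_le mult_right_mono)
    moreover have "norm (cinner h g *\<^sub>C f) \<le> norm h * norm g * norm f"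
      by (simp add: norm_scaleC norm_cinner_le mult_right_mono)
    moreover have "norm ((cinner g f * cinner h f) *\<^sub>C f) \<le> (norm g * norm f) * (norm h * norm f) * norm f"
      unfolding norm_scaleC norm_mult by (intro mult_mono norm_cinner_le) auto
    ultimately show ?thesis
      by (intro order_trans[OF norm_triangle_ineq4] order_trans[OF add_right_mono[OF norm_triangle_ineq4]])
        (simp add: algebra_simps)
  qed
  have lin: "bounded_linear ?F"
  proof (rule bounded_linear_intro[where K = ?K])
    show "?F (x + y) = ?F x + ?F y" for x y
      by (simp add: cinner_add_left scaleC_add_left distrib_left)
    show "?F (r *\<^sub>R x) = r *\<^sub>R ?F x" for r x
    proof -
      have "(of_real r * c) *\<^sub>C y = r *\<^sub>R (c *\<^sub>C y)" for c and y :: 'a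
        by (metis scaleC_of_real scaleC_scaleC)
      then show ?thesis
        by (simp add: cinner_scaleR_left mult.left_commute scaleR_diff_right)
    qed
  qed (rule bound)
  show app: "blinfun_apply (rank_two_lift f g) h = ?F h" for h
    by (simp add: rank_two_lift_def bounded_linear_Blinfun_apply[OF lin])
  show "norm (rank_two_lift f g) \<le> 3 * norm g" if "norm f = 1"
    using bound that by (intro norm_blinfun_bound) (auto simp: app mult.commute)
qed

lemma rank_two_lift_antihermitian:
  assumes "inner f g = 0"
  shows "rank_two_lift f g \<in> antihermitian_ops"
  unfolding antihermitian_ops_def bounded_ops_def
proof (safe)
  fix c x
  show "blinfun_apply (rank_two_lift f g) (c *\<^sub>C x) = c *\<^sub>C blinfun_apply (rank_two_lift f g) x"
    by (simp add: rank_two_lift_apply scaleC_diff_right scaleC_scaleC cinner_scaleC_left ac_simps)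
next
  fix x y
  have diff_left: "cinner (a - b) c = cinner a c - cinner b c" for a b c :: 'a
    by (metis add_diff_cancel_right' cinner_add_left diff_add_cancel)
  have diff_right: "cinner a (b - c) = cinner a b - cinner a c" for a b c :: 'a
    by (metis add_diff_cancel_right' cinner_add_right diff_add_cancel)
  have "Re (cinner g f) = 0"
    using assms by (simp add: Re_cinner inner_commute)
  then have "cnj (cinner g f) = - cinner g f"
    by (simp add: complex_eq_iff)
  then show "cinner (blinfun_apply (rank_two_lift f g) x) y = - cinner x (blinfun_apply (rank_two_lift f g) y)"
    by (simp add: rank_two_lift_apply diff_left diff_right cinner_scaleC_left cinner_scaleC_right
        cinner_commute[of f y] cinner_commute[of g y] cinner_commute[of x] cinner_add_left cinner_add_right algebra_simps)
qed

section \<open>Tangent vectors and an explicit lifting\<close>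

text \<open>
  These are the equations \<open>P\<^sup>* = P\<close>, \<open>P\<^sup>2 = P\<close>, \<open>P f = f\<close>, \<open>\<parallel>f\<parallel> = 1\<close> linearised at the point. They are visibly
  inherited by velocities of curves, while membership in \<^const>\<open>tangent_space\<close> asks for a lifting.
\<close>
definition tangent_vector :: "('a::complex_hilbert \<Rightarrow>\<^sub>L 'a) \<times> 'a \<Rightarrow> ('a \<Rightarrow>\<^sub>L 'a) \<times> 'a \<Rightarrow> bool" where
  "tangent_vector p V \<longleftrightarrow> fst V \<in> bounded_ops \<and>
    (\<forall>x y. inner (blinfun_apply (fst V) x) y = inner x (blinfun_apply (fst V) y)) \<and>
    (fst V o\<^sub>L fst p) + (fst p o\<^sub>L fst V) = fst V \<and>
    blinfun_apply (fst V) (snd p) + blinfun_apply (fst p) (snd V) = snd V \<and>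
    inner (snd V) (snd p) = 0"

lemma R_spaceD:
  assumes "(P, f) \<in> R_space"
  shows "P \<in> orthogonal_projections" "P \<in> bounded_ops" "P o\<^sub>L P = P"
    "blinfun_apply P (blinfun_apply P x) = blinfun_apply P x"
    "inner (blinfun_apply P x) y = inner x (blinfun_apply P y)"
    "cinner (blinfun_apply P x) y = cinner x (blinfun_apply P y)"
    "blinfun_apply P f = f" "norm f = 1" "inner f f = 1"
proof -
  show *: "P \<in> orthogonal_projections" "P o\<^sub>L P = P" "norm f = 1" "blinfun_apply P f = f"
    "P \<in> bounded_ops" "cinner (blinfun_apply P x) y = cinner x (blinfun_apply P y)"
    using assms by (auto simp: R_space_def orthogonal_projections_def)
  show "inner (blinfun_apply P x) y = inner x (blinfun_apply P y)"
    using *(1) by (auto simp: orthogonal_projections_iff)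
  show "blinfun_apply P (blinfun_apply P x) = blinfun_apply P x"
    using arg_cong[OF *(2), of "\<lambda>A. blinfun_apply A x"] by simp
  show "inner f f = 1" using *(3) by (simp add: dot_square_norm)
qed

lemma tangent_vector_delta_map:
  assumes p: "(P, f) \<in> R_space" and X: "X \<in> antihermitian_ops"
  shows "tangent_vector (P, f) (delta_map (P, f) X)"
proof -
  have "blinfun_apply P f = f" "\<And>x. blinfun_apply P (blinfun_apply P x) = blinfun_apply P x"
    using R_spaceD[OF p] by auto
  then show ?thesis
    using X antihermitian_inner_self[OF X, of f] R_spaceD(2,5)[OF p]
    by (auto simp: tangent_vector_def antihermitian_ops_iff blinfun_eq_iff blinfun.bilinear_simps inner_simps)
qed

lemma tangent_vector_diff:
  "tangent_vector p V \<Longrightarrow> tangent_vector p W \<Longrightarrow> tangent_vector p (V - W)"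
  by (auto simp: tangent_vector_def inner_simps blinfun.bilinear_simps op_compose.diff_left op_compose.diff_right algebra_simps)

text \<open>
  The commutator \<open>[W, P]\<close> lifts the component \<open>W\<close> of the projection, since \<open>P W P = 0\<close> makes
  \<open>W\<close> purely off-diagonal. It sends \<open>f\<close> to \<open>(1 - P) w\<close>, and what is left is to send \<open>f\<close> to \<open>P w\<close>
  by an operator that commutes with \<open>P\<close>, which a rank-two operator built from \<open>f\<close> and \<open>P w\<close> does. The
  point of the lemma is the norm bound, uniform in the base point.
\<close>
lemma tangent_vector_lift:
  assumes p: "(P, f) \<in> R_space" and V: "tangent_vector (P, f) V"
  obtains Z where "Z \<in> antihermitian_ops" "delta_map (P, f) Z = V"
    "norm Z \<le> 2 * norm (fst V) + 3 * norm (snd V)"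
proof -
  obtain W w where VW: "V = (W, w)" by (cases V)
  note P = R_spaceD[OF p]
  define g where "g = blinfun_apply P w"
  define Z0 where "Z0 = (W o\<^sub>L P) - (P o\<^sub>L W)"
  define Z where "Z = Z0 + rank_two_lift f g"
  have W: "W \<in> bounded_ops" "\<And>x y. inner (blinfun_apply W x) y = inner x (blinfun_apply W y)"
    and WP: "\<And>x. blinfun_apply W (blinfun_apply P x) + blinfun_apply P (blinfun_apply W x) = blinfun_apply W x"
    and w: "blinfun_apply W f + g = w" "inner w f = 0"
    using V by (auto simp: tangent_vector_def VW g_def blinfun_eq_iff blinfun.bilinear_simps)
  have PWP: "blinfun_apply P (blinfun_apply W (blinfun_apply P x)) = 0" for x
    using arg_cong[OF WP[of x], of "blinfun_apply P"] P(4) by (simp add: blinfun.add_right)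
  have fg: "inner f g = 0"
    using w(2) P(5)[of f w] P(7) by (simp add: g_def inner_commute)
  have Pg: "blinfun_apply P g = g" using P(4) by (simp add: g_def)
  have Z0: "Z0 \<in> antihermitian_ops"
    using W P by (auto simp: antihermitian_ops_iff Z0_def blinfun.bilinear_simps inner_simps)
  have "Z \<in> antihermitian_ops"
    unfolding Z_def using Z0 rank_two_lift_antihermitian[OF fg] by auto
  moreover have "delta_map (P, f) Z = V"
  proof -
    have comm: "blinfun_apply (rank_two_lift f g) (blinfun_apply P x) = blinfun_apply P (blinfun_apply (rank_two_lift f g) x)" for x
      using P(7) Pg bounded_opsD[OF P(2)]
      by (simp add: rank_two_lift_apply P(6) blinfun.bilinear_simps)
    have 1: "(Z o\<^sub>L P) - (P o\<^sub>L Z) = W"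
    proof (rule blinfun_eqI)
      fix x
      show "blinfun_apply ((Z o\<^sub>L P) - (P o\<^sub>L Z)) x = blinfun_apply W x"
        using WP[of x] P(4) by (simp add: Z_def Z0_def blinfun.bilinear_simps comm PWP)
    qed
    have "cinner f g + cinner g f = 0"
      using fg by (subst cinner_commute) (simp add: complex_eq_iff Re_cinner inner_commute)
    then have "blinfun_apply (rank_two_lift f g) f = g"
      using P(8) scaleC_of_real[of 1 g] scaleC_add_left[of "cinner f g" "cinner g f" f] scaleC_of_real[of 0 f]
      by (simp add: rank_two_lift_apply cinner_self algebra_simps)
    moreover have "blinfun_apply Z0 f = blinfun_apply W f"
      using PWP[of f] P(7) by (simp add: Z0_def blinfun.bilinear_simps)
    ultimately have "blinfun_apply Z f = w"
      using w by (simp add: Z_def blinfun.bilinear_simps)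
    with 1 show ?thesis by (simp add: VW)
  qed
  moreover have "norm Z \<le> 2 * norm (fst V) + 3 * norm (snd V)"
  proof -
    have P1: "norm P \<le> 1" using norm_orthogonal_projection_le P(1) by blast
    have "norm (W o\<^sub>L P) \<le> norm W * 1"
      by (rule order_trans[OF norm_blinfun_compose]) (intro mult_left_mono P1, simp)
    moreover have "norm (P o\<^sub>L W) \<le> 1 * norm W"
      by (rule order_trans[OF norm_blinfun_compose]) (intro mult_right_mono P1, simp)
    ultimately have "norm Z0 \<le> 2 * norm W"
      unfolding Z0_def by (intro order_trans[OF norm_triangle_ineq4]) simp
    moreover have "norm g \<le> 1 * norm w"
      unfolding g_def by (rule order_trans[OF norm_blinfun]) (intro mult_right_mono P1, simp)
    ultimately show ?thesis
      unfolding Z_def VW using norm_rank_two_lift_le[OF P(8), of g]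
      by (intro order_trans[OF norm_triangle_ineq]) simp
  qed
  ultimately show ?thesis using that by blast
qed

lemma norm_components_le: "norm (fst z) \<le> norm z" "norm (snd z) \<le> norm z"
  using norm_fst_le[of "fst z" "snd z"] norm_snd_le[of "snd z" "fst z"] by simp_all

lemma delta_map_diff: "delta_map p (X - Y) = delta_map p X - delta_map p Y"
  by (cases p) (simp add: blinfun_eq_iff blinfun.bilinear_simps)

lemma delta_map_scaleR: "delta_map p (r *\<^sub>R X) = r *\<^sub>R delta_map p X"
  by (cases p) (simp add: blinfun_eq_iff blinfun.bilinear_simps scaleR_diff_right)

section \<open>The quotient norm\<close>

lemma quotient_norm_le:
  assumes "X \<in> antihermitian_ops" "delta_map p X = V"
  shows "quotient_norm p V \<le> norm X"
  unfolding quotient_norm_def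
  by (rule cINF_lower) (use assms in \<open>auto simp: liftings_def intro: bdd_belowI[of _ 0]\<close>)

lemma quotient_norm_approx:
  assumes "X \<in> antihermitian_ops" "delta_map p X = V" "quotient_norm p V < r"
  obtains Y where "Y \<in> antihermitian_ops" "delta_map p Y = V" "norm Y < r"
proof -
  have "norm ` liftings p V \<noteq> {}" using assms by (auto simp: liftings_def)
  from cInf_lessD[OF this] assms(3) obtain Y where "Y \<in> liftings p V" "norm Y < r"
    unfolding quotient_norm_def by auto
  then show ?thesis using that by (auto simp: liftings_def)
qed

text \<open>
  A lifting at \<open>p\<close> becomes a lifting at a nearby point after adding the explicit lifting of the small
  tangent vector by which it misses the target. This compares quotient norms at different base points
  without moving one point to the other by a unitary.
\<close>
lemma quotient_norm_perturb:
  assumes p: "p \<in> R_space" and q: "q \<in> R_space" and V: "tangent_vector p V" and W: "tangent_vector q W"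
  shows "quotient_norm q W \<le> quotient_norm p V * (1 + 7 * norm (q - p)) + 5 * norm (W - V)"
proof -
  obtain P f Q g where pq: "p = (P, f)" "q = (Q, g)" by (metis surj_pair)
  have bound: "quotient_norm q W \<le> norm X * (1 + 7 * norm (q - p)) + 5 * norm (W - V)"
    if X: "X \<in> antihermitian_ops" "delta_map p X = V" for X
  proof -
    have "tangent_vector (Q, g) (W - delta_map (Q, g) X)"
      using tangent_vector_diff[OF W[unfolded pq] tangent_vector_delta_map] q X(1) pq by blast
    then obtain Z where Z: "Z \<in> antihermitian_ops" "delta_map (Q, g) Z = W - delta_map (Q, g) X"
      "norm Z \<le> 2 * norm (fst (W - delta_map (Q, g) X)) + 3 * norm (snd (W - delta_map (Q, g) X))"
      using tangent_vector_lift[of Q g] q pq by blast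
    have d: "norm (Q - P) \<le> norm (q - p)" "norm (g - f) \<le> norm (q - p)"
      using norm_fst_le[of "Q - P" "g - f"] norm_snd_le[of "g - f" "Q - P"] by (auto simp: pq)
    have "fst (W - delta_map (Q, g) X) = fst (W - V) - ((X o\<^sub>L (Q - P)) - ((Q - P) o\<^sub>L X))"
      using X(2) by (auto simp: pq blinfun_eq_iff blinfun.bilinear_simps)
    also have "norm \<dots> \<le> norm (W - V) + (norm X * norm (q - p) + norm (q - p) * norm X)"
    proof (rule order_trans[OF norm_triangle_ineq4], rule add_mono)
      show "norm (fst (W - V)) \<le> norm (W - V)"
        by (rule norm_components_le)
      show "norm ((X o\<^sub>L (Q - P)) - ((Q - P) o\<^sub>L X)) \<le> norm X * norm (q - p) + norm (q - p) * norm X"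
        by (intro order_trans[OF norm_triangle_ineq4] add_mono order_trans[OF norm_blinfun_compose] mult_mono d) auto
    qed
    finally have 1: "norm (fst (W - delta_map (Q, g) X)) \<le> norm (W - V) + 2 * (norm X * norm (q - p))"
      by (simp add: mult.commute)
    have "snd (W - delta_map (Q, g) X) = snd (W - V) - blinfun_apply X (g - f)"
      using X(2) by (auto simp: pq blinfun.bilinear_simps)
    also have "norm \<dots> \<le> norm (W - V) + norm X * norm (q - p)"
    proof (rule order_trans[OF norm_triangle_ineq4], rule add_mono[OF norm_components_le(2)])
      show "norm (blinfun_apply X (g - f)) \<le> norm X * norm (q - p)"
        by (intro order_trans[OF norm_blinfun] mult_left_mono d) auto
    qed
    finally have 2: "norm (snd (W - delta_map (Q, g) X)) \<le> norm (W - V) + norm X * norm (q - p)" .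
    have "quotient_norm q W \<le> norm (X + Z)"
    proof (rule quotient_norm_le)
      show "delta_map q (X + Z) = W"
        using Z(2) by (cases W) (auto simp: pq blinfun_eq_iff blinfun.bilinear_simps algebra_simps)
    qed (use X Z in auto)
    also have "\<dots> \<le> norm X + norm Z" by (rule norm_triangle_ineq)
    finally show ?thesis using Z(3) 1 2 by (simp add: algebra_simps)
  qed
  obtain X where X: "X \<in> antihermitian_ops" "delta_map p X = V"
    using tangent_vector_lift[of P f V] p V pq by metis
  show ?thesis
  proof (rule field_le_epsilon)
    fix e :: real assume "e > 0"
    let ?c = "1 + 7 * norm (q - p)"
    have c: "?c > 0" by (simp add: add_pos_nonneg)
    obtain Y where Y: "Y \<in> antihermitian_ops" "delta_map p Y = V" "norm Y < quotient_norm p V + e / ?c"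
      using quotient_norm_approx[OF X, of "quotient_norm p V + e / ?c"] c \<open>e > 0\<close> by auto
    have "norm Y * ?c \<le> (quotient_norm p V + e / ?c) * ?c"
      using Y(3) c by (intro mult_right_mono) auto
    also have "\<dots> = quotient_norm p V * ?c + e" using c by (simp add: distrib_right)
    finally show "quotient_norm q W \<le> quotient_norm p V * ?c + 5 * norm (W - V) + e"
      using bound[OF Y(1,2)] by simp
  qed
qed

text \<open>
  The perturbation inequality is used in both directions to squeeze the value between two expressions
  that converge to the value at the limit point.
\<close>
lemma continuous_on_quotient_norm:
  fixes \<gamma> :: "real \<Rightarrow> ('a::complex_hilbert \<Rightarrow>\<^sub>L 'a) \<times> 'a"
  assumes "continuous_on S \<gamma>" "continuous_on S V"
    and R: "\<And>s. s \<in> S \<Longrightarrow> \<gamma> s \<in> R_space" and V: "\<And>s. s \<in> S \<Longrightarrow> tangent_vector (\<gamma> s) (V s)"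
  shows "continuous_on S (\<lambda>s. quotient_norm (\<gamma> s) (V s))"
  unfolding continuous_on_def
proof
  fix x assume x: "x \<in> S"
  let ?F = "at x within S"
  let ?q = "\<lambda>s. quotient_norm (\<gamma> s) (V s)"
  have \<gamma>: "(\<gamma> \<longlongrightarrow> \<gamma> x) ?F" and V': "(V \<longlongrightarrow> V x) ?F"
    using assms x by (auto simp: continuous_on_def)
  have S: "\<forall>\<^sub>F s in ?F. s \<in> S" by (auto simp: eventually_at_filter)
  show "(?q \<longlongrightarrow> ?q x) ?F"
  proof (rule tendsto_sandwich)
    show "\<forall>\<^sub>F s in ?F. (?q x - 5 * norm (V s - V x)) / (1 + 7 * norm (\<gamma> s - \<gamma> x)) \<le> ?q s"
      using S
    proof eventually_elim
      case (elim s)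
      then show ?case
        using quotient_norm_perturb[OF R[OF elim] R[OF x] V[OF elim] V[OF x]]
        by (simp add: pos_divide_le_eq add_pos_nonneg norm_minus_commute)
    qed
    show "\<forall>\<^sub>F s in ?F. ?q s \<le> ?q x * (1 + 7 * norm (\<gamma> s - \<gamma> x)) + 5 * norm (V s - V x)"
      using S by eventually_elim (intro quotient_norm_perturb R V x)
    show "((\<lambda>s. (?q x - 5 * norm (V s - V x)) / (1 + 7 * norm (\<gamma> s - \<gamma> x))) \<longlongrightarrow> ?q x) ?F"
      by (rule tendsto_eq_intros \<gamma> V' refl | simp)+
    show "((\<lambda>s. ?q x * (1 + 7 * norm (\<gamma> s - \<gamma> x)) + 5 * norm (V s - V x)) \<longlongrightarrow> ?q x) ?F"
      by (rule tendsto_eq_intros \<gamma> V' refl | simp)+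
  qed
qed

text \<open>
  Differentiate the defining identities of the space along the curve; on a nondegenerate interval
  one-sided derivatives are unique.
\<close>
lemma tangent_vector_of_curve:
  fixes \<gamma> :: "real \<Rightarrow> ('a::complex_hilbert \<Rightarrow>\<^sub>L 'a) \<times> 'a"
  assumes "c < d" and s: "s \<in> {c..d}" and R: "\<And>t. t \<in> {c..d} \<Longrightarrow> \<gamma> t \<in> R_space"
    and V: "(\<gamma> has_vector_derivative V) (at s within {c..d})"
  shows "tangent_vector (\<gamma> s) V"
proof -
  define P f where "P t = fst (\<gamma> t)" and "f t = snd (\<gamma> t)" for t
  have Pf: "(P t, f t) \<in> R_space" if "t \<in> {c..d}" for t
    using R[OF that] by (simp add: P_def f_def)
  let ?F = "at s within {c..d}"
  have P': "(P has_vector_derivative fst V) ?F" and f': "(f has_vector_derivative snd V) ?F"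
    using bounded_linear.has_vector_derivative[OF bounded_linear_fst V]
      bounded_linear.has_vector_derivative[OF bounded_linear_snd V]
    by (simp_all add: P_def[abs_def] f_def[abs_def])
  have Px: "((\<lambda>t. blinfun_apply (P t) x) has_vector_derivative blinfun_apply (fst V) x) ?F" for x
    by (rule bounded_linear.has_vector_derivative[OF blinfun.bounded_linear_left P'])
  have uniq: "A = B" if "(F has_vector_derivative A) ?F" "(G has_vector_derivative B) ?F"
    "\<And>t. t \<in> {c..d} \<Longrightarrow> F t = G t" for F G :: "real \<Rightarrow> 'b::real_normed_vector" and A B
    using vector_derivative_unique_within_closed_interval[of c d s F A B] assms(1) s that
      has_vector_derivative_transform[OF s, of F G] by auto
  have "blinfun_apply (fst V) (z *\<^sub>C x) = z *\<^sub>C blinfun_apply (fst V) x" for z x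
    by (rule uniq[OF Px bounded_linear.has_vector_derivative[OF bounded_linear_scaleC Px]])
      (use R_spaceD(2)[OF Pf] bounded_opsD in blast)
  moreover have "inner (blinfun_apply (fst V) x) y = inner x (blinfun_apply (fst V) y)" for x y
    by (rule uniq[OF bounded_linear.has_vector_derivative[OF bounded_linear_inner_left Px]
          bounded_linear.has_vector_derivative[OF bounded_linear_inner_right Px]])
      (use R_spaceD(5)[OF Pf] in blast)
  moreover have "(P s o\<^sub>L fst V) + (fst V o\<^sub>L P s) = fst V"
    by (rule uniq[OF op_compose.has_vector_derivative[OF P' P'] P']) (use R_spaceD(3)[OF Pf] in blast)
  moreover have "blinfun_apply (P s) (snd V) + blinfun_apply (fst V) (f s) = snd V"
    by (rule uniq[OF blinfun.has_vector_derivative[OF P' f'] f']) (use R_spaceD(7)[OF Pf] in blast)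
  moreover have "inner (f s) (snd V) + inner (snd V) (f s) = 0"
    by (rule uniq[OF bounded_bilinear.has_vector_derivative[OF bounded_bilinear_inner f' f']
          has_vector_derivative_const[of 1]]) (use R_spaceD(9)[OF Pf] in blast)
  ultimately show ?thesis
    unfolding tangent_vector_def bounded_ops_def
    by (auto simp: P_def f_def inner_commute add.commute)
qed

section \<open>Unitaries and exponentials of anti-Hermitian operators\<close>

lemma op_exp_bounded_ops:
  assumes "X \<in> bounded_ops"
  shows "op_exp X \<in> bounded_ops"
proof -
  have *: "blinfun_apply (op_power X n) (c *\<^sub>C x) = c *\<^sub>C blinfun_apply (op_power X n) x" for n c x
    by (induction n) (auto simp: bounded_opsD[OF assms])
  have "blinfun_apply (op_exp X) (c *\<^sub>C x) = c *\<^sub>C blinfun_apply (op_exp X) x" for c x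
    using bounded_linear.sums[OF bounded_linear_scaleC op_exp_apply_sums[of X x], of c]
      op_exp_apply_sums[of X "c *\<^sub>C x"]
    by (simp add: * scaleC_scaleR sums_unique2)
  then show ?thesis by (simp add: bounded_ops_def)
qed

text \<open>
  A unitary is carried together with its inverse, which doubles as its adjoint, so that adjoints of
  general operators never enter.
\<close>
definition unitary_pair :: "('a::complex_hilbert \<Rightarrow>\<^sub>L 'a) \<Rightarrow> ('a \<Rightarrow>\<^sub>L 'a) \<Rightarrow> bool" where
  "unitary_pair U W \<longleftrightarrow> U \<in> bounded_ops \<and> W \<in> bounded_ops \<and>
    U o\<^sub>L W = id_blinfun \<and> W o\<^sub>L U = id_blinfun \<and>
    (\<forall>x y. inner (blinfun_apply U x) y = inner x (blinfun_apply W y))"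

lemma unitary_pairD:
  assumes "unitary_pair U W"
  shows "U \<in> bounded_ops" "W \<in> bounded_ops"
    "blinfun_apply U (blinfun_apply W x) = x" "blinfun_apply W (blinfun_apply U x) = x"
    "inner (blinfun_apply U x) y = inner x (blinfun_apply W y)"
    "inner (blinfun_apply W x) y = inner x (blinfun_apply U y)"
    "norm (blinfun_apply U x) = norm x" "norm (blinfun_apply W x) = norm x"
    "norm U \<le> 1" "norm W \<le> 1"
proof -
  show *: "U \<in> bounded_ops" "W \<in> bounded_ops"
    "blinfun_apply U (blinfun_apply W x) = x" "blinfun_apply W (blinfun_apply U x) = x"
    "inner (blinfun_apply U x) y = inner x (blinfun_apply W y)"
    "inner (blinfun_apply W x) y = inner x (blinfun_apply U y)" for x y
    using assms by (auto simp: unitary_pair_def blinfun_eq_iff) (metis inner_commute)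
  show "norm (blinfun_apply U x) = norm x" "norm (blinfun_apply W x) = norm x" for x
    by (simp_all add: norm_eq_sqrt_inner *)
  then show "norm U \<le> 1" "norm W \<le> 1"
    by (auto intro!: norm_blinfun_bound)
qed

lemma unitary_pair_sym: "unitary_pair U W \<Longrightarrow> unitary_pair W U"
  unfolding unitary_pair_def by (metis inner_commute)

lemma unitary_pair_compose:
  "unitary_pair U W \<Longrightarrow> unitary_pair U' W' \<Longrightarrow> unitary_pair (U o\<^sub>L U') (W' o\<^sub>L W)"
  by (auto simp: unitary_pair_def blinfun_eq_iff)

lemma unitary_pair_id: "unitary_pair id_blinfun id_blinfun"
  by (auto simp: unitary_pair_def blinfun_eq_iff)

lemma norm_compose_contraction:
  "norm A \<le> 1 \<Longrightarrow> norm (A o\<^sub>L B) \<le> norm B" "norm A \<le> 1 \<Longrightarrow> norm (B o\<^sub>L A) \<le> norm B"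
  by (rule order_trans[OF norm_blinfun_compose], metis mult_right_mono mult_1 norm_ge_zero,
      rule order_trans[OF norm_blinfun_compose], metis mult_left_mono mult.right_neutral norm_ge_zero)

text \<open>
  The exponential preserves inner products since their derivative along the flow vanishes by
  anti-Hermitian symmetry; together with the inverse this gives the adjoint.
\<close>
lemma unitary_pair_op_exp:
  assumes X: "X \<in> antihermitian_ops"
  shows "unitary_pair (op_exp (t *\<^sub>R X)) (op_exp (- t *\<^sub>R X))"
proof -
  have Xb: "X \<in> bounded_ops" and Xi: "\<And>x y. inner (blinfun_apply X x) y = - inner x (blinfun_apply X y)"
    using X by (auto simp: antihermitian_ops_iff)
  have inv: "blinfun_apply (op_exp (- s *\<^sub>R X)) (blinfun_apply (op_exp (s *\<^sub>R X)) x) = x" for s x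
    using arg_cong[OF op_exp_minus_cancel[of s X], of "\<lambda>A. blinfun_apply A x"] by simp
  have iso: "inner (blinfun_apply (op_exp (s *\<^sub>R X)) x) (blinfun_apply (op_exp (s *\<^sub>R X)) y) = inner x y" for s x y
  proof -
    define G where "G s = inner (blinfun_apply (op_exp (s *\<^sub>R X)) x) (blinfun_apply (op_exp (s *\<^sub>R X)) y)" for s
    have d: "((\<lambda>s. blinfun_apply (op_exp (s *\<^sub>R X)) z) has_vector_derivative
        blinfun_apply X (blinfun_apply (op_exp (s *\<^sub>R X)) z)) (at s within UNIV)" for s z
      using bounded_linear.has_vector_derivative[OF blinfun.bounded_linear_left op_exp_has_vector_derivative[of X s UNIV], of z]
      by simp
    have "(G has_vector_derivative 0) (at s within UNIV)" for s
      unfolding G_def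
      using bounded_bilinear.has_vector_derivative[OF bounded_bilinear_inner d[where z=x] d[where z=y]]
      by (simp add: Xi)
    then obtain c where "\<And>s. G s = c"
      using has_derivative_zero_constant[of UNIV G] by (auto simp: has_vector_derivative_def)
    then have "G s = G 0" by simp
    then show ?thesis by (simp add: G_def)
  qed
  have inv': "blinfun_apply (op_exp (s *\<^sub>R X)) (blinfun_apply (op_exp (- s *\<^sub>R X)) x) = x" for s x
    using inv[of "- s"] by simp
  have "inner (blinfun_apply (op_exp (t *\<^sub>R X)) x) y = inner x (blinfun_apply (op_exp (- t *\<^sub>R X)) y)" for x y
    using iso[of t x "blinfun_apply (op_exp (- t *\<^sub>R X)) y"] by (simp only: inv')
  then show ?thesis
    using Xb inv inv' unfolding unitary_pair_def
    by (auto simp: blinfun_eq_iff intro!: op_exp_bounded_ops bounded_ops_closed(6) simp del: scaleR_minus_left)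
qed

lemma norm_op_exp_diff_le:
  assumes X: "X \<in> antihermitian_ops"
  shows "norm (op_exp (h *\<^sub>R X) - id_blinfun) \<le> norm X * \<bar>h\<bar>"
proof -
  have "norm (op_exp (h *\<^sub>R X) - op_exp (0 *\<^sub>R X)) \<le> norm X * norm (h - 0)"
  proof (rule differentiable_bound[where S = UNIV and f' = "\<lambda>t u. u *\<^sub>R (X o\<^sub>L op_exp (t *\<^sub>R X))"])
    fix s :: real
    show "((\<lambda>s. op_exp (s *\<^sub>R X)) has_derivative (\<lambda>u. u *\<^sub>R (X o\<^sub>L op_exp (s *\<^sub>R X)))) (at s within UNIV)"
      using op_exp_has_vector_derivative[of X s UNIV] by (simp add: has_vector_derivative_def)
    have "norm (X o\<^sub>L op_exp (s *\<^sub>R X)) \<le> norm X"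
      by (rule norm_compose_contraction) (rule unitary_pairD(9)[OF unitary_pair_op_exp[OF X]])
    then show "onorm (\<lambda>u. u *\<^sub>R (X o\<^sub>L op_exp (s *\<^sub>R X))) \<le> norm X"
      by (intro onorm_le) (simp add: mult.commute[of "norm X"] mult_left_mono)
  qed auto
  then show ?thesis by simp
qed

section \<open>Angles on the unit sphere\<close>

text \<open>
  Split \<open>x\<close> and \<open>z\<close> into their parts along \<open>y\<close> and orthogonal to \<open>y\<close>. The orthogonal parts have norms
  \<open>sin \<alpha>\<close> and \<open>sin \<beta>\<close>, so Cauchy-Schwarz and the addition theorem give \<open>\<langle>x, z\<rangle> \<ge> cos (\<alpha> + \<beta>)\<close>.
\<close>
lemma arccos_inner_triangle:
  fixes x y z :: "'a::real_inner"
  assumes "norm x = 1" "norm y = 1" "norm z = 1"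
  shows "arccos (inner x z) \<le> arccos (inner x y) + arccos (inner y z)"
proof -
  have bd: "\<bar>inner u v\<bar> \<le> 1" if "norm u = 1" "norm v = 1" for u v :: 'a
    using Cauchy_Schwarz_ineq2[of u v] that by simp
  define \<alpha> \<beta> where "\<alpha> = arccos (inner x y)" and "\<beta> = arccos (inner y z)"
  have ab: "0 \<le> \<alpha>" "\<alpha> \<le> pi" "0 \<le> \<beta>" "\<beta> \<le> pi" and cos: "cos \<alpha> = inner x y" "cos \<beta> = inner y z"
    using bd[OF assms(1,2)] bd[OF assms(2,3)] unfolding \<alpha>_def \<beta>_def
    by (auto intro!: arccos_lbound arccos_ubound cos_arccos_abs)
  show ?thesis
  proof (cases "\<alpha> + \<beta> \<le> pi")
    case True
    have n1: "inner u u = 1" if "norm u = 1" for u :: 'a using that by (simp add: dot_square_norm)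
    have "(norm (x - cos \<alpha> *\<^sub>R y))\<^sup>2 = (sin \<alpha>)\<^sup>2"
      unfolding power2_norm_eq_inner sin_squared_eq
      by (simp add: inner_simps n1 assms cos inner_commute power2_eq_square)
    then have nx: "norm (x - cos \<alpha> *\<^sub>R y) = sin \<alpha>"
      using sin_ge_zero[of \<alpha>] ab by (simp add: power2_eq_iff_nonneg)
    have "(norm (z - cos \<beta> *\<^sub>R y))\<^sup>2 = (sin \<beta>)\<^sup>2"
      unfolding power2_norm_eq_inner sin_squared_eq
      by (simp add: inner_simps n1 assms cos inner_commute power2_eq_square)
    then have nz: "norm (z - cos \<beta> *\<^sub>R y) = sin \<beta>"
      using sin_ge_zero[of \<beta>] ab by (simp add: power2_eq_iff_nonneg)
    have "- (sin \<alpha> * sin \<beta>) \<le> inner (x - cos \<alpha> *\<^sub>R y) (z - cos \<beta> *\<^sub>R y)"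
      using Cauchy_Schwarz_ineq2[of "x - cos \<alpha> *\<^sub>R y" "z - cos \<beta> *\<^sub>R y"] by (simp add: nx nz abs_le_iff)
    also have "\<dots> = inner x z - cos \<alpha> * cos \<beta>"
      by (simp add: inner_simps n1 assms cos inner_commute)
    finally have "cos (\<alpha> + \<beta>) \<le> inner x z"
      by (simp add: cos_add)
    then have "arccos (inner x z) \<le> arccos (cos (\<alpha> + \<beta>))"
      using bd[OF assms(1,3)] by (intro arccos_le_mono[THEN iffD2]) auto
    then show ?thesis
      using True ab by (simp add: arccos_cos \<alpha>_def \<beta>_def)
  next
    case False
    then show ?thesis
      using arccos_ubound[of "inner x z"] bd[OF assms(1,3)] unfolding \<alpha>_def \<beta>_def by (simp add: abs_le_iff)
  qed
qed

text \<open>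
  A chord of length \<open>2 sin (\<theta> / 2)\<close> subtends the angle \<open>\<theta>\<close>.
\<close>
lemma arccos_inner_near:
  fixes x y :: "'a::real_inner"
  assumes "norm x = 1" "norm y = 1"
  shows "arccos (inner x y) = 2 * arcsin (norm (x - y) / 2)"
proof -
  define c where "c = norm (x - y) / 2"
  have c: "0 \<le> c" "c \<le> 1"
    using norm_triangle_ineq4[of x y] assms by (auto simp: c_def)
  have "inner x y = 1 - 2 * c\<^sup>2"
    using dot_norm_neg[of x y] assms by (simp add: c_def power_divide field_simps)
  also have "\<dots> = cos (2 * arcsin c)"
    using c by (simp add: cos_double_sin)
  finally show ?thesis
    using c arcsin_bounded[of c] arcsin_le_mono[of 0 c]
    by (simp add: arccos_cos flip: c_def)
qed

text \<open>
  Turns a bound on the chord between a vector and its image under a short exponential into a bound on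
  the angle, at the price of a factor arbitrarily close to \<open>1\<close>.
\<close>
lemma arcsin_le_near_zero:
  fixes k :: real
  assumes "k > 0"
  obtains d where "d > 0" "\<And>c. 0 \<le> c \<Longrightarrow> c < d \<Longrightarrow> arcsin c \<le> (1 + k) * c"
proof -
  have "(arcsin has_derivative (\<lambda>h. h * 1)) (at 0)"
    using DERIV_arcsin[of 0] by (simp add: has_real_derivative_iff_has_vector_derivative has_vector_derivative_def)
  then obtain d where "d > 0" "\<And>c. norm (c - 0) < d \<Longrightarrow> norm (arcsin c - arcsin 0 - (c - 0) * 1) \<le> k * norm (c - 0)"
    using assms unfolding has_derivative_at_alt by blast
  note d = this
  show ?thesis
  proof (rule that[OF d(1)])
    fix c :: real assume "0 \<le> c" "c < d"
    then have "\<bar>arcsin c - c\<bar> \<le> k * c" using d(2)[of c] by simp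
    then show "arcsin c \<le> (1 + k) * c" by (simp add: distrib_right)
  qed
qed

section \<open>Following a curve by unitaries\<close>

text \<open>
  Some unitary carries \<open>p\<close> to \<open>q\<close> up to \<open>e\<close> and turns no unit vector by more than the angle \<open>L\<close>. The error
  on the projection is measured by \<open>U P - Q U\<close>, which has the same norm as \<open>U P U\<^sup>* - Q\<close> and is easier to
  compose.
\<close>
definition joined_upto :: "('a::complex_hilbert \<Rightarrow>\<^sub>L 'a) \<times> 'a \<Rightarrow> ('a \<Rightarrow>\<^sub>L 'a) \<times> 'a \<Rightarrow> real \<Rightarrow> real \<Rightarrow> bool" where
  "joined_upto p q L e \<longleftrightarrow> (\<exists>U W. unitary_pair U W \<and>
    (\<forall>x. norm x = 1 \<longrightarrow> arccos (inner (blinfun_apply U x) x) \<le> L) \<and>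
    norm ((U o\<^sub>L fst p) - (fst q o\<^sub>L U)) \<le> e \<and>
    norm (blinfun_apply U (snd p) - snd q) \<le> e)"

lemma joined_upto_refl: "joined_upto p p 0 0"
  unfolding joined_upto_def
  by (intro exI[of _ id_blinfun] conjI unitary_pair_id) (auto simp: dot_square_norm blinfun_eq_iff blinfun.bilinear_simps)

lemma joined_upto_mono: "joined_upto p q L e \<Longrightarrow> L \<le> L' \<Longrightarrow> e \<le> e' \<Longrightarrow> joined_upto p q L' e'"
  unfolding joined_upto_def by (meson order_trans)

lemma joined_upto_trans:
  assumes "joined_upto p q L e" "joined_upto q r L' e'"
  shows "joined_upto p r (L + L') (e + e')"
proof -
  obtain U W where U: "unitary_pair U W" "\<And>x. norm x = 1 \<Longrightarrow> arccos (inner (blinfun_apply U x) x) \<le> L"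
    "norm ((U o\<^sub>L fst p) - (fst q o\<^sub>L U)) \<le> e" "norm (blinfun_apply U (snd p) - snd q) \<le> e"
    using assms(1) unfolding joined_upto_def by blast
  obtain U' W' where U': "unitary_pair U' W'" "\<And>x. norm x = 1 \<Longrightarrow> arccos (inner (blinfun_apply U' x) x) \<le> L'"
    "norm ((U' o\<^sub>L fst q) - (fst r o\<^sub>L U')) \<le> e'" "norm (blinfun_apply U' (snd q) - snd r) \<le> e'"
    using assms(2) unfolding joined_upto_def by blast
  note n = unitary_pairD(7)[OF U(1)] unitary_pairD(7)[OF U'(1)]
  have "arccos (inner (blinfun_apply (U' o\<^sub>L U) x) x) \<le> L + L'" if "norm x = 1" for x
    using arccos_inner_triangle[of "blinfun_apply (U' o\<^sub>L U) x" "blinfun_apply U x" x]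
      U(2)[OF that] U'(2)[of "blinfun_apply U x"] that by (simp add: n)
  moreover have "norm (((U' o\<^sub>L U) o\<^sub>L fst p) - (fst r o\<^sub>L (U' o\<^sub>L U))) \<le> e + e'"
  proof -
    have "((U' o\<^sub>L U) o\<^sub>L fst p) - (fst r o\<^sub>L (U' o\<^sub>L U)) =
        (U' o\<^sub>L ((U o\<^sub>L fst p) - (fst q o\<^sub>L U))) + (((U' o\<^sub>L fst q) - (fst r o\<^sub>L U')) o\<^sub>L U)"
      by (simp add: blinfun_eq_iff blinfun.bilinear_simps)
    also have "norm \<dots> \<le> e + e'"
      by (intro norm_triangle_mono order_trans[OF norm_compose_contraction(1) U(3)]
          order_trans[OF norm_compose_contraction(2) U'(3)] unitary_pairD(9)[OF U(1)] unitary_pairD(9)[OF U'(1)])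
    finally show ?thesis .
  qed
  moreover have "norm (blinfun_apply (U' o\<^sub>L U) (snd p) - snd r) \<le> e + e'"
  proof -
    have "blinfun_apply (U' o\<^sub>L U) (snd p) - snd r =
        blinfun_apply U' (blinfun_apply U (snd p) - snd q) + (blinfun_apply U' (snd q) - snd r)"
      by (simp add: blinfun.bilinear_simps)
    also have "norm \<dots> \<le> e + e'"
      using U(4) U'(4) by (intro norm_triangle_mono) (simp_all add: n)
    finally show ?thesis .
  qed
  ultimately show ?thesis
    unfolding joined_upto_def using unitary_pair_compose[OF U'(1) U(1)] by blast
qed

text \<open>
  For \<open>h = s' - s\<close> the unitary is the exponential of \<open>h X\<close>. To first order it moves \<open>\<gamma> s\<close> by \<open>h V\<close>, which is
  how far the curve itself moves, so the error is \<open>o(h)\<close>. The base point \<open>x\<close> is allowed to lie anywhere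
  between \<open>s\<close> and \<open>s'\<close>, as the subdivision argument that uses this lemma requires.
\<close>
lemma joined_upto_local:
  fixes \<gamma> :: "real \<Rightarrow> ('a::complex_hilbert \<Rightarrow>\<^sub>L 'a) \<times> 'a"
  assumes R: "\<And>s. s \<in> {c..d} \<Longrightarrow> \<gamma> s \<in> R_space"
    and x: "x \<in> {c..d}"
    and V: "(\<gamma> has_vector_derivative V) (at x within {c..d})"
    and X: "X \<in> antihermitian_ops" "delta_map (\<gamma> x) X = V"
    and "\<kappa> > 0"
  obtains \<delta> where "\<delta> > 0"
    "\<And>s s'. c \<le> s \<Longrightarrow> s \<le> x \<Longrightarrow> x \<le> s' \<Longrightarrow> s' \<le> d \<Longrightarrow> s' - s < \<delta> \<Longrightarrow>
      joined_upto (\<gamma> s) (\<gamma> s') ((norm X + \<kappa>) * (s' - s)) (\<kappa> * (s' - s))"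
proof -
  define m where "m = norm X"
  have m: "m \<ge> 0" by (simp add: m_def)
  \<comment> \<open>the error budget: three first-order remainders, and two differences of projections against \<open>X\<close>\<close>
  define k where "k = \<kappa> / (3 + 2 * m)"
  have k: "k > 0" "(3 + 2 * m) * k = \<kappa>"
    using m \<open>\<kappa> > 0\<close> by (auto simp: k_def add_pos_nonneg)
  define P f where "P s = fst (\<gamma> s)" and "f s = snd (\<gamma> s)" for s
  have Pn: "norm (P s) \<le> 1" and fn: "norm (f s) = 1" if "s \<in> {c..d}" for s
    using R[OF that] norm_orthogonal_projection_le unfolding P_def f_def by (auto simp: R_space_def)
  have V12: "(X o\<^sub>L P x) - (P x o\<^sub>L X) = fst V" "blinfun_apply X (f x) = snd V"
    using X(2) unfolding P_def f_def by (cases "\<gamma> x"; auto)+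
  have "((\<lambda>h. op_exp (h *\<^sub>R X)) has_derivative (\<lambda>h. h *\<^sub>R X)) (at 0)"
    using op_exp_has_vector_derivative[of X 0 UNIV] blinfun_eq_iff[of "X o\<^sub>L id_blinfun" X]
    by (simp add: has_vector_derivative_def)
  then obtain d1 where d1: "d1 > 0"
    "\<And>h. norm (h - 0) < d1 \<Longrightarrow> norm (op_exp (h *\<^sub>R X) - op_exp (0 *\<^sub>R X) - (h - 0) *\<^sub>R X) \<le> k * norm (h - 0)"
    using k(1) unfolding has_derivative_at_alt by blast
  obtain d2 where d2: "d2 > 0"
    "\<And>s. s \<in> {c..d} \<Longrightarrow> norm (s - x) < d2 \<Longrightarrow> norm (\<gamma> s - \<gamma> x - (s - x) *\<^sub>R V) \<le> k * norm (s - x)"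
    using V k(1) unfolding has_vector_derivative_def has_derivative_within_alt by blast
  have "continuous (at x within {c..d}) \<gamma>"
    using V by (rule has_vector_derivative_continuous)
  then obtain d3 where d3: "d3 > 0"
    "\<And>s. s \<in> {c..d} \<Longrightarrow> dist s x < d3 \<Longrightarrow> dist (\<gamma> s) (\<gamma> x) < k"
    using k(1) unfolding continuous_within_eps_delta by blast
  obtain d4 where d4: "d4 > 0" "\<And>c. 0 \<le> c \<Longrightarrow> c < d4 \<Longrightarrow> arcsin c \<le> (1 + \<kappa> / (m + 1)) * c"
    using arcsin_le_near_zero[of "\<kappa> / (m + 1)"] m \<open>\<kappa> > 0\<close> by auto
  show ?thesis
  proof (rule that[of "Min {d1, d2, d3, d4 / (m + 1)}"])
    show "0 < Min {d1, d2, d3, d4 / (m + 1)}" using d1 d2 d3 d4 m by auto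
    fix s s' assume s: "c \<le> s" "s \<le> x" "x \<le> s'" "s' \<le> d" "s' - s < Min {d1, d2, d3, d4 / (m + 1)}"
    define h where "h = s' - s"
    define U where "U = op_exp (h *\<^sub>R X)"
    have h: "0 \<le> h" "h < d1" "h < d2" "h < d3" "h < d4 / (m + 1)"
      using s by (auto simp: h_def)
    have sI: "s \<in> {c..d}" "s' \<in> {c..d}" using s x by auto
    have U: "unitary_pair U (op_exp (- h *\<^sub>R X))"
      unfolding U_def by (rule unitary_pair_op_exp[OF X(1)])
    have angle: "arccos (inner (blinfun_apply U y) y) \<le> (m + \<kappa>) * h" if y: "norm y = 1" for y
    proof -
      define r where "r = norm (blinfun_apply U y - y) / 2"
      have "norm (blinfun_apply (U - id_blinfun) y) \<le> norm (U - id_blinfun) * norm y"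
        by (rule norm_blinfun)
      also have "\<dots> \<le> m * h"
        using norm_op_exp_diff_le[OF X(1), of h] h(1) y by (simp add: U_def m_def)
      finally have r: "0 \<le> r" "r \<le> m * h / 2" by (auto simp: r_def blinfun.diff_left)
      have "(m + 1) * h < d4" using h(5) m by (simp add: field_simps)
      then have "r < d4" using r h(1) m by (simp add: algebra_simps)
      then have "arcsin r \<le> (1 + \<kappa> / (m + 1)) * r" using r d4 by simp
      also have "\<dots> \<le> (1 + \<kappa> / (m + 1)) * (m * h / 2)"
        using r m \<open>\<kappa> > 0\<close> by (intro mult_left_mono) auto
      finally have "2 * arcsin r \<le> (m + \<kappa> * (m / (m + 1))) * h"
        using m by (simp add: field_simps)
      also have "\<dots> \<le> (m + \<kappa> * 1) * h"
        using m h \<open>\<kappa> > 0\<close> by (intro mult_right_mono add_left_mono mult_left_mono) (auto simp: field_simps)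
      finally show ?thesis
        using y unitary_pairD(7)[OF U] by (simp add: arccos_inner_near r_def)
    qed
    define E where "E = U - id_blinfun - h *\<^sub>R X"
    have E: "norm E \<le> k * h"
      using d1(2)[of h] h by (simp add: E_def U_def)
    define T where "T = \<gamma> s - \<gamma> s' + h *\<^sub>R V"
    have T: "norm T \<le> k * h"
    proof -
      have "T = (\<gamma> s - \<gamma> x - (s - x) *\<^sub>R V) - (\<gamma> s' - \<gamma> x - (s' - x) *\<^sub>R V)"
        by (simp add: T_def h_def algebra_simps)
      also have "norm \<dots> \<le> k * norm (s - x) + k * norm (s' - x)"
        using s h by (intro order_trans[OF norm_triangle_ineq4] add_mono d2(2) sI) (auto simp: h_def)
      also have "\<dots> = k * h"
        using s by (simp add: h_def algebra_simps)
      finally show ?thesis .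
    qed
    have near: "norm (P s - P x) \<le> k" "norm (P s' - P x) \<le> k" "norm (f s - f x) \<le> k"
    proof -
      have "dist (\<gamma> s) (\<gamma> x) < k" "dist (\<gamma> s') (\<gamma> x) < k"
        using s h by (auto intro!: d3(2) sI simp: h_def dist_real_def)
      then have *: "norm (\<gamma> s - \<gamma> x) \<le> k" "norm (\<gamma> s' - \<gamma> x) \<le> k" by (auto simp: dist_norm)
      show "norm (P s - P x) \<le> k" "norm (P s' - P x) \<le> k" "norm (f s - f x) \<le> k"
        using order_trans[OF norm_components_le(1) *(1)] order_trans[OF norm_components_le(1) *(2)]
          order_trans[OF norm_components_le(2) *(1)]
        by (simp_all add: P_def f_def)
    qed
    have proj: "norm ((U o\<^sub>L P s) - (P s' o\<^sub>L U)) \<le> \<kappa> * h"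
    proof -
      \<comment> \<open>the terms of first order in \<open>h\<close> cancel because \<open>X\<close> lifts the velocity at \<open>x\<close>\<close>
      have "(U o\<^sub>L P s) - (P s' o\<^sub>L U) =
          fst T + h *\<^sub>R ((X o\<^sub>L (P s - P x)) - ((P s' - P x) o\<^sub>L X)) + ((E o\<^sub>L P s) - (P s' o\<^sub>L E))"
        unfolding T_def E_def by (simp add: V12(1)[symmetric] P_def[symmetric] blinfun_eq_iff blinfun.bilinear_simps algebra_simps)
      also have "norm \<dots> \<le> k * h + h * (m * k + k * m) + (k * h + k * h)"
      proof (intro norm_triangle_mono)
        show "norm (fst T) \<le> k * h" using T norm_components_le(1) order_trans by blast
        have "norm ((X o\<^sub>L (P s - P x)) - ((P s' - P x) o\<^sub>L X)) \<le> m * k + k * m"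
          unfolding m_def
          by (intro order_trans[OF norm_triangle_ineq4] add_mono order_trans[OF norm_blinfun_compose] mult_mono near) (use k(1) in auto)
        then show "norm (h *\<^sub>R ((X o\<^sub>L (P s - P x)) - ((P s' - P x) o\<^sub>L X))) \<le> h * (m * k + k * m)"
          using h(1) by (simp add: mult_left_mono)
        show "norm ((E o\<^sub>L P s) - (P s' o\<^sub>L E)) \<le> k * h + k * h"
          by (intro order_trans[OF norm_triangle_ineq4] add_mono
              order_trans[OF norm_compose_contraction(1) E] order_trans[OF norm_compose_contraction(2) E] Pn sI)
      qed
      also have "\<dots> = ((3 + 2 * m) * k) * h" by (simp add: algebra_simps)
      finally show ?thesis using k(2) by simp
    qed
    have vec: "norm (blinfun_apply U (f s) - f s') \<le> \<kappa> * h"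
    proof -
      have "blinfun_apply U (f s) - f s' = snd T + h *\<^sub>R blinfun_apply X (f s - f x) + blinfun_apply E (f s)"
        unfolding T_def E_def by (simp add: V12(2)[symmetric] f_def[symmetric] blinfun.bilinear_simps algebra_simps)
      also have "norm \<dots> \<le> k * h + h * (m * k) + k * h"
      proof (intro norm_triangle_mono)
        show "norm (snd T) \<le> k * h" using T norm_components_le(2) order_trans by blast
        have "norm (blinfun_apply X (f s - f x)) \<le> m * k"
          unfolding m_def by (intro order_trans[OF norm_blinfun] mult_left_mono near) auto
        then show "norm (h *\<^sub>R blinfun_apply X (f s - f x)) \<le> h * (m * k)"
          using h(1) by (simp add: mult_left_mono)
        show "norm (blinfun_apply E (f s)) \<le> k * h"
          using norm_blinfun[of E "f s"] E fn[OF sI(1)] by simp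
      qed
      also have "\<dots> \<le> ((3 + 2 * m) * k) * h" using k(1) m h(1) by (simp add: algebra_simps)
      finally show ?thesis using k(2) by simp
    qed
    show "joined_upto (\<gamma> s) (\<gamma> s') ((norm X + \<kappa>) * (s' - s)) (\<kappa> * (s' - s))"
      unfolding joined_upto_def
      using U angle proj vec by (auto simp: h_def m_def P_def f_def)
  qed
qed

text \<open>
  Being joined with cost given by an integral is additive over adjacent intervals, so by bisection it
  suffices to have it on all short intervals around each point. There the local lemma applies with a
  lifting whose norm is within \<open>\<kappa> / 4\<close> of the speed, and the speed is nearly constant.
\<close>
lemma joined_upto_smooth_piece:
  fixes \<gamma> :: "real \<Rightarrow> ('a::complex_hilbert \<Rightarrow>\<^sub>L 'a) \<times> 'a"
  assumes cd: "c < d" and R: "\<And>s. s \<in> {c..d} \<Longrightarrow> \<gamma> s \<in> R_space"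
    and V: "\<And>s. s \<in> {c..d} \<Longrightarrow> (\<gamma> has_vector_derivative V s) (at s within {c..d})"
    and cont: "continuous_on {c..d} V" and "\<kappa> > 0"
  defines "l \<equiv> \<lambda>s. quotient_norm (\<gamma> s) (V s)"
  shows "l integrable_on {c..d}"
    and "joined_upto (\<gamma> c) (\<gamma> d) (integral {c..d} l + \<kappa> * (d - c)) (\<kappa> * (d - c))"
proof -
  have tan: "tangent_vector (\<gamma> s) (V s)" if "s \<in> {c..d}" for s
    using tangent_vector_of_curve[OF cd that R V[OF that]] .
  have "continuous_on {c..d} \<gamma>"
    using has_vector_derivative_continuous[OF V] by (simp add: continuous_on_eq_continuous_within)
  then have lc: "continuous_on {c..d} l"
    unfolding l_def using cont R tan by (rule continuous_on_quotient_norm)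
  then show int: "l integrable_on {c..d}"
    by (rule integrable_continuous_real)
  define Q where "Q s s' \<longleftrightarrow> (c \<le> s \<and> s \<le> s' \<and> s' \<le> d \<longrightarrow>
    joined_upto (\<gamma> s) (\<gamma> s') (integral {s..s'} l + \<kappa> * (s' - s)) (\<kappa> * (s' - s)))" for s s'
  have "Q c d"
    using less_imp_le[OF cd]
  proof (induction rule: Bolzano)
    case (trans r s t)
    show ?case unfolding Q_def
    proof safe
      assume "c \<le> r" "r \<le> t" "t \<le> d"
      then have "joined_upto (\<gamma> r) (\<gamma> t) ((integral {r..s} l + \<kappa> * (s - r)) + (integral {s..t} l + \<kappa> * (t - s)))
          (\<kappa> * (s - r) + \<kappa> * (t - s))"
        using trans unfolding Q_def by (intro joined_upto_trans[of _ "\<gamma> s"]) auto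
      moreover have "integral {r..s} l + integral {s..t} l = integral {r..t} l"
        using trans \<open>c \<le> r\<close> \<open>t \<le> d\<close>
        by (intro Henstock_Kurzweil_Integration.integral_combine integrable_subinterval_real[OF int]) auto
      ultimately show "joined_upto (\<gamma> r) (\<gamma> t) (integral {r..t} l + \<kappa> * (t - r)) (\<kappa> * (t - r))"
        by (elim joined_upto_mono) (auto simp: algebra_simps)
    qed
  next
    case (local x)
    then have x: "x \<in> {c..d}" by simp
    obtain P f where Pf: "\<gamma> x = (P, f)" by fastforce
    obtain X0 where "X0 \<in> antihermitian_ops" "delta_map (\<gamma> x) X0 = V x"
      using tangent_vector_lift[of P f "V x"] R[OF x] tan[OF x] Pf by metis
    then obtain X where X: "X \<in> antihermitian_ops" "delta_map (\<gamma> x) X = V x" "norm X < l x + \<kappa> / 4"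
      using quotient_norm_approx[of X0 "\<gamma> x" "V x" "l x + \<kappa> / 4"] \<open>\<kappa> > 0\<close> by (auto simp: l_def)
    obtain d1 where d1: "d1 > 0" "\<And>s s'. c \<le> s \<Longrightarrow> s \<le> x \<Longrightarrow> x \<le> s' \<Longrightarrow> s' \<le> d \<Longrightarrow> s' - s < d1 \<Longrightarrow>
        joined_upto (\<gamma> s) (\<gamma> s') ((norm X + \<kappa> / 4) * (s' - s)) (\<kappa> / 4 * (s' - s))"
      using joined_upto_local[of c d \<gamma> x "V x" X "\<kappa> / 4"] R x V X \<open>\<kappa> > 0\<close>
      by (metis divide_pos_pos zero_less_numeral)
    obtain d2 where d2: "d2 > 0" "\<And>s. s \<in> {c..d} \<Longrightarrow> dist s x < d2 \<Longrightarrow> dist (l s) (l x) < \<kappa> / 4"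
      using lc x \<open>\<kappa> > 0\<close> unfolding continuous_on_iff by (metis divide_pos_pos zero_less_numeral)
    show ?case
    proof (intro exI[of _ "min d1 d2"] conjI allI impI)
      show "0 < min d1 d2" using d1 d2 by simp
      fix s s' assume s: "s \<le> x \<and> x \<le> s' \<and> s' - s < min d1 d2"
      show "Q s s'" unfolding Q_def
      proof safe
        assume s': "c \<le> s" "s \<le> s'" "s' \<le> d"
        have "integral {s..s'} (\<lambda>_. l x - \<kappa> / 4) \<le> integral {s..s'} l"
        proof (rule integral_le)
          show "l integrable_on {s..s'}"
            using s' by (intro integrable_subinterval_real[OF int]) auto
          fix u assume u: "u \<in> {s..s'}"
          then have "dist u x < d2" using s by (auto simp: dist_real_def)
          then have "\<bar>l u - l x\<bar> < \<kappa> / 4"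
            using d2(2)[of u] u s' by (simp add: dist_real_def)
          then show "l x - \<kappa> / 4 \<le> l u" by linarith
        qed auto
        then have 1: "(l x - \<kappa> / 4) * (s' - s) \<le> integral {s..s'} l"
          using s' by (simp add: mult.commute)
        have 2: "(norm X + \<kappa> / 4) * (s' - s) \<le> (l x + \<kappa> / 2) * (s' - s)"
          using X(3) s' by (intro mult_right_mono) auto
        have L: "(norm X + \<kappa> / 4) * (s' - s) \<le> integral {s..s'} l + \<kappa> * (s' - s)"
        proof -
          have "(l x + \<kappa> / 2) * (s' - s) = (l x - \<kappa> / 4) * (s' - s) + 3 / 4 * (\<kappa> * (s' - s))"
            by (simp add: field_simps)
          moreover have "0 \<le> \<kappa> * (s' - s)" using \<open>\<kappa> > 0\<close> s' by simp
          ultimately show ?thesis using 1 2 by linarith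
        qed
        have E: "\<kappa> / 4 * (s' - s) \<le> \<kappa> * (s' - s)"
          using \<open>\<kappa> > 0\<close> s' by (intro mult_right_mono) auto
        show "joined_upto (\<gamma> s) (\<gamma> s') (integral {s..s'} l + \<kappa> * (s' - s)) (\<kappa> * (s' - s))"
          using s s' by (intro joined_upto_mono[OF d1(2) L E]) auto
      qed
    qed
  qed
  then show "joined_upto (\<gamma> c) (\<gamma> d) (integral {c..d} l + \<kappa> * (d - c)) (\<kappa> * (d - c))"
    using cd by (simp add: Q_def)
qed

lemma joined_upto_curve_length:
  fixes \<gamma> :: "real \<Rightarrow> ('a::complex_hilbert \<Rightarrow>\<^sub>L 'a) \<times> 'a"
  assumes "a < b" "piecewise_smooth a b \<gamma>" and R: "\<And>s. s \<in> {a..b} \<Longrightarrow> \<gamma> s \<in> R_space" and "\<kappa> > 0"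
  shows "joined_upto (\<gamma> a) (\<gamma> b) (curve_length a b \<gamma> + \<kappa> * (b - a)) (\<kappa> * (b - a))"
proof -
  obtain k :: nat and p where p: "p 0 = a" "p k = b"
    "\<And>i. i < k \<Longrightarrow> p i < p (Suc i)" "\<And>i. i < k \<Longrightarrow> smooth_on_interval (p i) (p (Suc i)) \<gamma>"
    using assms(2) unfolding piecewise_smooth_def by blast
  define F where "F t = quotient_norm (\<gamma> t) (vector_derivative \<gamma> (at t within {a..b}))" for t
  have mono: "p i \<le> p j" if "i \<le> j" "j \<le> k" for i j
    using that by (induction rule: dec_induct) (auto intro!: order_trans[OF _ less_imp_le[OF p(3)]])
  have "i \<le> k \<Longrightarrow> F integrable_on {a..p i} \<and>
      joined_upto (\<gamma> a) (\<gamma> (p i)) (integral {a..p i} F + \<kappa> * (p i - a)) (\<kappa> * (p i - a))" for i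
  proof (induction i)
    case 0
    show ?case using joined_upto_refl[of "\<gamma> a"] integrable_on_refl[of F a] by (simp add: p(1))
  next
    case (Suc i)
    then have i: "i < k" by simp
    note IH = Suc.IH[OF less_imp_le[OF i]]
    let ?I = "{p i..p (Suc i)}"
    have le: "a \<le> p i" "p i < p (Suc i)" "p (Suc i) \<le> b"
      using mono[of 0 i] p(3)[OF i] mono[of "Suc i" k] i p(1,2) by auto
    obtain D where D: "D 0 = \<gamma>"
      "\<And>n t. t \<in> ?I \<Longrightarrow> (D n has_vector_derivative D (Suc n) t) (at t within ?I)"
      using p(4)[OF i] unfolding smooth_on_interval_def by blast
    have D1: "(\<gamma> has_vector_derivative D 1 t) (at t within ?I)" if "t \<in> ?I" for t
      using D(2)[OF that, of 0] D(1) by simp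
    have "continuous_on ?I (D 1)"
      using has_vector_derivative_continuous[OF D(2)] by (simp add: continuous_on_eq_continuous_within)
    note piece = joined_upto_smooth_piece[OF le(2) _ D1 this \<open>\<kappa> > 0\<close>]
    let ?l = "\<lambda>s. quotient_norm (\<gamma> s) (D 1 s)"
    have RI: "\<gamma> s \<in> R_space" if "s \<in> ?I" for s
      using R that le by auto
    \<comment> \<open>the two ends are excluded: there the derivative within \<open>{a..b}\<close> may not exist\<close>
    have eq: "F t = ?l t" if "t \<in> ?I - {p i, p (Suc i)}" for t
    proof -
      have t: "p i < t" "t < p (Suc i)" "a < t" "t < b" using that le by auto
      have "(\<gamma> has_vector_derivative D 1 t) (at t)"
        using D1[of t] t by (simp add: at_within_Icc_at)
      then have "vector_derivative \<gamma> (at t within {a..b}) = D 1 t"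
        using t by (simp add: at_within_Icc_at vector_derivative_at)
      then show ?thesis by (simp add: F_def)
    qed
    have "(F has_integral integral ?I ?l) ?I"
      by (rule has_integral_spike_finite[OF _ _ integrable_integral[OF piece(1)[OF RI]], of "{p i, p (Suc i)}"])
        (use eq in auto)
    moreover have "(F has_integral integral {a..p i} F) {a..p i}"
      using IH by blast
    ultimately have int: "(F has_integral integral {a..p i} F + integral ?I ?l) {a..p (Suc i)}"
      using le by (intro has_integral_combine[of a "p i" "p (Suc i)"]) auto
    have "joined_upto (\<gamma> a) (\<gamma> (p (Suc i)))
        ((integral {a..p i} F + \<kappa> * (p i - a)) + (integral ?I ?l + \<kappa> * (p (Suc i) - p i)))
        (\<kappa> * (p i - a) + \<kappa> * (p (Suc i) - p i))"
      using IH piece(2)[OF RI] by (intro joined_upto_trans[of _ "\<gamma> (p i)"]) auto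
    then have "joined_upto (\<gamma> a) (\<gamma> (p (Suc i))) (integral {a..p (Suc i)} F + \<kappa> * (p (Suc i) - a)) (\<kappa> * (p (Suc i) - a))"
      by (rule joined_upto_mono) (auto simp: integral_unique[OF int] algebra_simps)
    then show ?case using int by blast
  qed
  from this[of k] show ?thesis
    by (simp add: p(2) curve_length_def F_def[abs_def])
qed

section \<open>The one-parameter curve of a minimal lifting\<close>

text \<open>
  Since \<open>X\<close> commutes with its exponentials, \<open>X\<close> itself lifts the velocity at every parameter.
\<close>
lemma exp_curve_has_vector_derivative:
  "(exp_curve X p has_vector_derivative delta_map (exp_curve X p t) X) (at t within S)"
proof -
  let ?A = "op_exp (t *\<^sub>R X)" and ?B = "op_exp (- t *\<^sub>R X)"
  have A: "((\<lambda>t. op_exp (t *\<^sub>R X)) has_vector_derivative (X o\<^sub>L ?A)) (at t within S)"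
    by (rule op_exp_has_vector_derivative)
  have "((\<lambda>t. op_exp (t *\<^sub>R X) o\<^sub>L fst p) has_vector_derivative ((X o\<^sub>L ?A) o\<^sub>L fst p)) (at t within S)"
    by (rule bounded_linear.has_vector_derivative[OF op_compose.bounded_linear_left A])
  from op_compose.has_vector_derivative[OF this op_exp_minus_has_vector_derivative[of X t S]]
  have 1: "((\<lambda>t. (op_exp (t *\<^sub>R X) o\<^sub>L fst p) o\<^sub>L op_exp (- t *\<^sub>R X)) has_vector_derivative
      ((?A o\<^sub>L fst p) o\<^sub>L (- (X o\<^sub>L ?B))) + (((X o\<^sub>L ?A) o\<^sub>L fst p) o\<^sub>L ?B)) (at t within S)" .
  have 2: "((\<lambda>t. blinfun_apply (op_exp (t *\<^sub>R X)) (snd p)) has_vector_derivative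
      blinfun_apply (X o\<^sub>L ?A) (snd p)) (at t within S)"
    by (rule bounded_linear.has_vector_derivative[OF blinfun.bounded_linear_left A])
  have comm: "blinfun_apply ?B (blinfun_apply X x) = blinfun_apply X (blinfun_apply ?B x)" for x
    using op_exp_commute[of "- t" X] unfolding blinfun_eq_iff by simp
  have "delta_map (exp_curve X p t) X =
      (((?A o\<^sub>L fst p) o\<^sub>L (- (X o\<^sub>L ?B))) + (((X o\<^sub>L ?A) o\<^sub>L fst p) o\<^sub>L ?B), blinfun_apply (X o\<^sub>L ?A) (snd p))"
    unfolding exp_curve_def using comm by (simp add: blinfun_eq_iff blinfun.bilinear_simps)
  then show ?thesis
    using has_vector_derivative_Pair[OF 1 2] by (simp add: exp_curve_def[abs_def])
qed

lemma curve_length_exp_curve_le: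
  assumes X: "X \<in> antihermitian_ops" "norm X \<le> 1"
  shows "curve_length (min 0 t) (max 0 t) (exp_curve X p) \<le> \<bar>t\<bar>"
proof -
  let ?I = "{min 0 t..max 0 t}"
  let ?F = "\<lambda>s. quotient_norm (exp_curve X p s) (vector_derivative (exp_curve X p) (at s within ?I))"
  have bound: "?F s \<le> 1" if "s \<in> ?I" "t \<noteq> 0" for s
  proof -
    have "vector_derivative (exp_curve X p) (at s within ?I) = delta_map (exp_curve X p s) X"
      using vector_derivative_within_cbox[OF _ _ exp_curve_has_vector_derivative[of X p s "cbox (min 0 t) (max 0 t)"]] that
      by (auto simp: min_def max_def)
    then show ?thesis using quotient_norm_le[OF X(1), of "exp_curve X p s"] X(2) by simp
  qed
  have "integral ?I ?F \<le> \<bar>t\<bar>"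
  proof (cases "t \<noteq> 0 \<and> ?F integrable_on ?I")
    case True
    then have "integral ?I ?F \<le> integral ?I (\<lambda>_. 1)"
      using bound by (intro integral_le) auto
    also have "\<dots> = \<bar>t\<bar>" by (simp add: min_def max_def)
    finally show ?thesis .
  next
    \<comment> \<open>the integral of a non-integrable function is \<open>0\<close>\<close>
    case False
    then show ?thesis by (auto simp: not_integrable_integral)
  qed
  then show ?thesis by (simp add: curve_length_def)
qed

text \<open>
  If \<open>X\<^sup>2 x = - x\<close> held, \<open>e\<^sup>t\<^sup>X x\<close> would be \<open>cos t x + sin t X x\<close>. In general, pull the rotated vector back
  by the flow; the result moves with speed at most \<open>\<parallel>X\<^sup>2 x + x\<parallel>\<close>.
\<close>
lemma op_exp_almost_rotation:
  assumes X: "X \<in> antihermitian_ops" and e: "norm (blinfun_apply X (blinfun_apply X x) + x) \<le> e"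
  shows "norm (blinfun_apply (op_exp (t *\<^sub>R X)) x - (cos t *\<^sub>R x + sin t *\<^sub>R blinfun_apply X x)) \<le> e * \<bar>t\<bar>"
proof -
  let ?y = "blinfun_apply X x" and ?z = "blinfun_apply X (blinfun_apply X x) + x"
  let ?B = "\<lambda>s. op_exp (- s *\<^sub>R X)"
  define H where "H s = blinfun_apply (?B s) (cos s *\<^sub>R x + sin s *\<^sub>R ?y)" for s
  have H': "(H has_derivative (\<lambda>h. h *\<^sub>R (- sin s *\<^sub>R blinfun_apply (?B s) ?z))) (at s within UNIV)" for s
  proof -
    have 1: "((\<lambda>s. cos s *\<^sub>R x + sin s *\<^sub>R ?y) has_vector_derivative (- sin s *\<^sub>R x + cos s *\<^sub>R ?y)) (at s within UNIV)"
      by (auto intro!: derivative_eq_intros)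
    have comm: "blinfun_apply (op_exp (- (s *\<^sub>R X))) (blinfun_apply X w) = blinfun_apply X (blinfun_apply (op_exp (- (s *\<^sub>R X))) w)" for w
      using op_exp_commute[of "- s" X] unfolding blinfun_eq_iff by simp
    have "blinfun_apply (?B s) (- sin s *\<^sub>R x + cos s *\<^sub>R ?y) +
        blinfun_apply (- (X o\<^sub>L ?B s)) (cos s *\<^sub>R x + sin s *\<^sub>R ?y) = - sin s *\<^sub>R blinfun_apply (?B s) ?z"
      by (simp add: blinfun.bilinear_simps comm algebra_simps)
    then show ?thesis
      using blinfun.has_vector_derivative[OF op_exp_minus_has_vector_derivative[of X s UNIV] 1]
      unfolding H_def[abs_def] has_vector_derivative_def by simp
  qed
  have scale: "norm (h *\<^sub>R w) \<le> e * norm h" if "norm w \<le> e" for h and w :: 'a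
    using that by (simp add: mult.commute[of e] mult_left_mono)
  have "norm (H t - H 0) \<le> e * norm (t - 0)"
  proof (rule differentiable_bound[where S = UNIV and f' = "\<lambda>s h. h *\<^sub>R (- sin s *\<^sub>R blinfun_apply (?B s) ?z)"])
    fix s :: real
    have "norm (- sin s *\<^sub>R blinfun_apply (?B s) ?z) \<le> 1 * e"
      using e unitary_pairD(8)[OF unitary_pair_op_exp[OF X, of s]] unfolding norm_scaleR
      by (intro mult_mono) auto
    then show "onorm (\<lambda>h. h *\<^sub>R (- sin s *\<^sub>R blinfun_apply (?B s) ?z)) \<le> e"
      by (intro onorm_le scale) simp
  qed (use H' in auto)
  also have "norm (H t - H 0) = norm (blinfun_apply (op_exp (t *\<^sub>R X)) (H t - H 0))"
    by (rule unitary_pairD(7)[OF unitary_pair_op_exp[OF X], symmetric])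
  also have "blinfun_apply (op_exp (t *\<^sub>R X)) (H t - H 0) =
      (cos t *\<^sub>R x + sin t *\<^sub>R ?y) - blinfun_apply (op_exp (t *\<^sub>R X)) x"
    unfolding H_def blinfun.diff_right unitary_pairD(3)[OF unitary_pair_op_exp[OF X]] by simp
  finally show ?thesis by (simp add: norm_minus_commute)
qed

text \<open>
  First variation of the norm at \<open>X\<close> in the direction \<open>Z\<close>: take a unit vector \<open>x\<close> for which
  \<open>\<parallel>(X + \<tau> Z) x\<parallel>\<close> is not much below \<open>1\<close>. Expanding \<open>\<parallel>(X + \<tau> Z) x\<parallel>\<^sup>2\<close> and using \<open>\<parallel>X x\<parallel> \<le> 1\<close>, the linear term
  cannot be very negative, and \<open>\<parallel>X x\<parallel>\<close> must be close to \<open>1\<close>. The latter forces \<open>X\<^sup>2 x \<approx> - x\<close> because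
  \<open>\<langle>X\<^sup>2 x, x\<rangle> = - \<parallel>X x\<parallel>\<^sup>2\<close>.
\<close>
lemma minimal_lifting_almost_norming:
  assumes X: "X \<in> antihermitian_ops" "norm X = 1"
    and min: "\<And>Y. Y \<in> antihermitian_ops \<Longrightarrow> delta_map p Y = delta_map p X \<Longrightarrow> 1 \<le> norm Y"
    and Z: "Z \<in> antihermitian_ops" "delta_map p Z = 0" and "e > 0"
  obtains x where "norm x = 1" "norm (blinfun_apply X (blinfun_apply X x) + x) \<le> e"
    "- e \<le> inner (blinfun_apply X x) (blinfun_apply Z x)"
proof -
  define N where "N = norm Z"
  \<comment> \<open>dominates the error coefficients in both estimates below\<close>
  define M where "M = 2 * (1 + N)\<^sup>2"
  have N: "N \<ge> 0" by (simp add: N_def)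
  have M: "M \<ge> 2" using N by (simp add: M_def)
  define \<tau> where "\<tau> = min (1 / 2) (min e (e\<^sup>2) / M)"
  have \<tau>: "0 < \<tau>" "\<tau> \<le> 1 / 2" "\<tau> * M \<le> e" "\<tau> * M \<le> e\<^sup>2"
  proof -
    have "\<tau> \<le> min e (e\<^sup>2) / M" by (simp add: \<tau>_def)
    then have "\<tau> * M \<le> min e (e\<^sup>2)" using M by (simp add: pos_le_divide_eq)
    then show "\<tau> * M \<le> e" "\<tau> * M \<le> e\<^sup>2" by auto
    show "\<tau> \<le> 1 / 2" unfolding \<tau>_def by (rule min.cobounded1)
  qed (use M \<open>e > 0\<close> in \<open>auto simp: \<tau>_def\<close>)
  have "\<tau>\<^sup>2 \<le> \<tau>" using \<tau>(1,2) by (simp add: power2_eq_square mult_left_le)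
  then have \<tau>2: "\<tau>\<^sup>2 \<le> \<tau>" "\<tau>\<^sup>2 < 1" using \<tau>(2) by auto
  define Y where "Y = X + \<tau> *\<^sub>R Z"
  have "delta_map p Y = delta_map p X"
    using Z(2) by (cases p) (auto simp: Y_def zero_prod_def blinfun_eq_iff blinfun.bilinear_simps)
  then have Y1: "1 \<le> norm Y"
    using min[of Y] X Z unfolding Y_def by blast
  obtain x where x: "norm x = 1" "1 - \<tau>\<^sup>2 \<le> (norm (blinfun_apply Y x))\<^sup>2"
  proof (rule ccontr)
    assume "\<not> thesis"
    then have "\<forall>x. norm x = 1 \<longrightarrow> (norm (blinfun_apply Y x))\<^sup>2 < 1 - \<tau>\<^sup>2"
      using that by (meson not_le)
    note less = this[rule_format]
    have "norm Y \<le> sqrt (1 - \<tau>\<^sup>2)"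
    proof (rule norm_blinfun_bound)
      fix v
      show "norm (blinfun_apply Y v) \<le> sqrt (1 - \<tau>\<^sup>2) * norm v"
      proof (cases "v = 0")
        case False
        let ?u = "(1 / norm v) *\<^sub>R v"
        have "norm (blinfun_apply Y ?u) \<le> sqrt (1 - \<tau>\<^sup>2)"
          using less[of ?u] False by (intro real_le_rsqrt) auto
        then show ?thesis using False by (simp add: blinfun.scaleR_right divide_le_eq mult.commute)
      qed simp
    qed (use \<tau>2 in auto)
    also have "\<dots> < 1" using \<tau>(1) \<tau>2 by (simp add: real_sqrt_less_iff)
    finally show False using Y1 by simp
  qed
  define y z where "y = blinfun_apply X x" and "z = blinfun_apply Z x"
  have nz: "norm z \<le> N" using norm_blinfun[of Z x] x(1) by (simp add: z_def N_def)
  have ny: "norm y \<le> 1" using norm_blinfun[of X x] x(1) X(2) by (simp add: y_def)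
  have "(norm (y + \<tau> *\<^sub>R z))\<^sup>2 = (norm y)\<^sup>2 + 2 * \<tau> * inner y z + \<tau>\<^sup>2 * (norm z)\<^sup>2"
    unfolding power2_norm_eq_inner by (simp add: inner_simps inner_commute power2_eq_square algebra_simps)
  moreover have "\<tau>\<^sup>2 * (norm z)\<^sup>2 \<le> \<tau>\<^sup>2 * N\<^sup>2"
    using nz by (intro mult_left_mono power_mono) auto
  ultimately have *: "1 - \<tau>\<^sup>2 \<le> (norm y)\<^sup>2 + 2 * \<tau> * inner y z + \<tau>\<^sup>2 * N\<^sup>2"
    using x(2) by (simp add: Y_def y_def z_def blinfun.bilinear_simps)
  have "- e \<le> inner y z"
  proof -
    have "(norm y)\<^sup>2 \<le> 1" using ny by (simp add: abs_square_le_1)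
    with * have "\<tau> * (- (\<tau> * (1 + N\<^sup>2))) \<le> \<tau> * (2 * inner y z)"
      by (simp add: algebra_simps power2_eq_square)
    then have "- (\<tau> * (1 + N\<^sup>2)) \<le> 2 * inner y z" using \<tau>(1) by (simp only: mult_le_cancel_left_pos)
    moreover have "\<tau> * (1 + N\<^sup>2) \<le> \<tau> * M"
      using \<tau>(1) N by (intro mult_left_mono) (auto simp: M_def power2_sum)
    ultimately show ?thesis using \<tau>(3) \<open>e > 0\<close> by linarith
  qed
  moreover have "norm (blinfun_apply X y + x) \<le> e"
  proof -
    have "inner y z \<le> 1 * N"
      using norm_cauchy_schwarz[of y z] mult_mono[OF ny nz] by simp
    then have "2 * \<tau> * inner y z \<le> 2 * \<tau> * N" using \<tau>(1) by (intro mult_left_mono) auto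
    moreover have "\<tau>\<^sup>2 * (1 + N\<^sup>2) \<le> \<tau> * (1 + N\<^sup>2)"
      using \<tau>2 by (intro mult_right_mono) auto
    ultimately have "2 * (1 - (norm y)\<^sup>2) \<le> \<tau> * M"
      using * by (simp add: M_def power2_eq_square algebra_simps)
    moreover have "(norm (blinfun_apply X y + x))\<^sup>2 \<le> 2 * (1 - (norm y)\<^sup>2)"
    proof -
      have "norm (blinfun_apply X y) \<le> 1"
        using norm_blinfun[of X y] X(2) ny by simp
      then have "(norm (blinfun_apply X y))\<^sup>2 \<le> 1" by (simp add: abs_square_le_1)
      moreover have "inner (blinfun_apply X y) x = - (norm y)\<^sup>2"
        using X(1) by (simp add: antihermitian_ops_iff y_def power2_norm_eq_inner)
      ultimately show ?thesis
        using x(1) dot_norm[of "blinfun_apply X y" x] by (simp add: field_simps)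
    qed
    ultimately have "(norm (blinfun_apply X y + x))\<^sup>2 \<le> e\<^sup>2" using \<tau>(4) by linarith
    then show ?thesis using \<open>e > 0\<close> by (simp add: power2_le_iff_abs_le)
  qed
  ultimately show ?thesis using that[OF x(1)] by (simp add: y_def z_def)
qed

text \<open>
  The comparison of \<open>\<langle>U\<^sup>-\<^sup>1 x, x\<rangle> + \<langle>U\<^sup>-\<^sup>1 X x, X x\<rangle>\<close> with \<open>cos L\<close> from below and with \<open>cos t\<close> from above. Since
  \<open>U\<close> reaches the end point only up to \<open>e\<close>, the operator \<open>A = (v - v\<^sup>-\<^sup>1) / 2\<close> is corrected by the explicit
  lifting of its defect; that lifting has norm at most \<open>5 e\<close> and enters doubled, whence the constant.
\<close>
lemma joined_upto_exp_curve_bound: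
  assumes p: "(P, f) \<in> R_space"
    and X: "X \<in> antihermitian_ops" "norm X = 1"
    and min: "\<And>Y. Y \<in> antihermitian_ops \<Longrightarrow> delta_map (P, f) Y = delta_map (P, f) X \<Longrightarrow> 1 \<le> norm Y"
    and t: "\<bar>t\<bar> \<le> pi / 2"
    and joined: "joined_upto (P, f) (exp_curve X (P, f) t) L e" and L: "L \<le> pi"
  shows "cos L \<le> cos t + 10 * e"
proof -
  define g g' where "g = op_exp (t *\<^sub>R X)" and "g' = op_exp (- t *\<^sub>R X)"
  have g: "unitary_pair g g'"
    unfolding g_def g'_def by (rule unitary_pair_op_exp[OF X(1)])
  let ?Q = "(g o\<^sub>L P) o\<^sub>L g'"
  obtain U W where U: "unitary_pair U W" "\<And>x. norm x = 1 \<Longrightarrow> arccos (inner (blinfun_apply U x) x) \<le> L"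
    "norm ((U o\<^sub>L P) - (?Q o\<^sub>L U)) \<le> e" "norm (blinfun_apply U f - blinfun_apply g f) \<le> e"
    using joined unfolding joined_upto_def exp_curve_def g_def g'_def by auto
  have angle: "cos L * (norm x)\<^sup>2 \<le> inner (blinfun_apply W x) x" for x
  proof (cases "x = 0")
    case False
    let ?u = "(1 / norm x) *\<^sub>R x"
    define c where "c = inner (blinfun_apply U ?u) ?u"
    have u: "norm ?u = 1" using False by simp
    have c: "\<bar>c\<bar> \<le> 1"
      unfolding c_def using Cauchy_Schwarz_ineq2[of "blinfun_apply U ?u" ?u] unitary_pairD(7)[OF U(1)] u by simp
    have "cos L \<le> cos (arccos c)"
      using U(2)[OF u] L c unfolding c_def[symmetric] by (intro cos_monotone_0_pi_le arccos_lbound) auto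
    also have "\<dots> = c" using c by (rule cos_arccos_abs)
    also have "\<dots> = inner (blinfun_apply U x) x / (norm x)\<^sup>2"
      by (simp add: c_def blinfun.scaleR_right power2_eq_square)
    finally show ?thesis
      using False unitary_pairD(5)[OF U(1), of x x] by (simp add: pos_le_divide_eq inner_commute)
  qed simp
  define v v' where "v = W o\<^sub>L g" and "v' = g' o\<^sub>L U"
  have v: "unitary_pair v v'"
    unfolding v_def v'_def by (rule unitary_pair_compose[OF unitary_pair_sym[OF U(1)] g])
  define A where "A = (1 / 2) *\<^sub>R (v - v')"
  have A: "A \<in> antihermitian_ops"
    using v unitary_pairD(5,6)[OF v] unfolding antihermitian_ops_iff A_def
    by (auto simp: blinfun.bilinear_simps inner_simps unitary_pair_def diff_divide_distrib)
  note inv = unitary_pairD(3,4)[OF g] unitary_pairD(3,4)[OF U(1)]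
  have fstA: "norm (fst (delta_map (P, f) A)) \<le> e"
  proof -
    let ?E = "(U o\<^sub>L P) - (?Q o\<^sub>L U)"
    have "fst (delta_map (P, f) A) = (1 / 2) *\<^sub>R (- ((W o\<^sub>L ?E) o\<^sub>L v) - (g' o\<^sub>L ?E))"
      by (simp add: A_def v_def v'_def blinfun_eq_iff blinfun.bilinear_simps inv algebra_simps)
    also have "norm \<dots> \<le> (1 / 2) * (e + e)"
      unfolding norm_scaleR
      using order_trans[OF norm_compose_contraction(2)[OF unitary_pairD(9)[OF v]]
          order_trans[OF norm_compose_contraction(1)[OF unitary_pairD(10)[OF U(1)]] U(3)]]
        order_trans[OF norm_compose_contraction(1)[OF unitary_pairD(10)[OF g]] U(3)]
      by (intro mult_mono order_trans[OF norm_triangle_ineq4] add_mono) auto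
    finally show ?thesis by simp
  qed
  have sndA: "norm (snd (delta_map (P, f) A)) \<le> e"
  proof -
    let ?r = "blinfun_apply U f - blinfun_apply g f"
    have "snd (delta_map (P, f) A) = (1 / 2) *\<^sub>R (- blinfun_apply W ?r - blinfun_apply g' ?r)"
      by (simp add: A_def v_def v'_def blinfun.bilinear_simps inv)
    also have "norm \<dots> \<le> (1 / 2) * (e + e)"
      unfolding norm_scaleR using U(4) unitary_pairD(8)[OF U(1)] unitary_pairD(8)[OF g]
      by (intro mult_mono order_trans[OF norm_triangle_ineq4] add_mono) auto
    finally show ?thesis by simp
  qed
  obtain Y where Y: "Y \<in> antihermitian_ops" "delta_map (P, f) Y = delta_map (P, f) A" "norm Y \<le> 5 * e"
    using tangent_vector_lift[OF p tangent_vector_delta_map[OF p A]] fstA sndA by (smt (verit))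
  define Z where "Z = A - Y"
  \<comment> \<open>the factor \<open>- sin t\<close> selects the sign of the first variation that is needed below\<close>
  have Z: "- sin t *\<^sub>R Z \<in> antihermitian_ops" "delta_map (P, f) (- sin t *\<^sub>R Z) = 0"
    using A Y(1,2) unfolding Z_def delta_map_scaleR delta_map_diff
    by (simp_all only: antihermitian_ops_closed(2,3) diff_self scaleR_zero_right)
  have cost: "cos t \<ge> 0" using t by (intro cos_ge_zero) auto
  have main: "cos L - cos t \<le> 10 * e + (3 + 2 * \<bar>t\<bar>) * \<eta>" if eta: "\<eta> > 0" for \<eta>
  proof -
    obtain x where x: "norm x = 1" "norm (blinfun_apply X (blinfun_apply X x) + x) \<le> \<eta>"
      "- \<eta> \<le> inner (blinfun_apply X x) (blinfun_apply (- sin t *\<^sub>R Z) x)"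
      using minimal_lifting_almost_norming[OF X min Z eta] by blast
    define y where "y = blinfun_apply X x"
    have ny: "norm y \<le> 1" using norm_blinfun[of X x] x(1) X(2) by (simp add: y_def)
    \<comment> \<open>\<open>r\<close> and \<open>s\<close> are the deviations of \<open>e\<^sup>-\<^sup>t\<^sup>X\<close> from a rotation at \<open>x\<close> and at \<open>y\<close>\<close>
    define r where "r = blinfun_apply g' x - (cos t *\<^sub>R x - sin t *\<^sub>R y)"
    have r: "norm r \<le> \<eta> * \<bar>t\<bar>"
      using op_exp_almost_rotation[OF X(1) x(2), of "- t"] by (simp add: r_def g'_def y_def)
    define s where "s = blinfun_apply X r - sin t *\<^sub>R (blinfun_apply X y + x)"
    have s: "norm s \<le> \<eta> * \<bar>t\<bar> + 1 * \<eta>"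
      unfolding s_def
    proof (intro order_trans[OF norm_triangle_ineq4] add_mono)
      show "norm (blinfun_apply X r) \<le> \<eta> * \<bar>t\<bar>"
        using norm_blinfun[of X r] X(2) r by simp
      show "norm (sin t *\<^sub>R (blinfun_apply X y + x)) \<le> 1 * \<eta>"
        unfolding norm_scaleR using x(2) by (intro mult_mono) (auto simp: y_def)
    qed
    have gx: "blinfun_apply g' x = cos t *\<^sub>R x - sin t *\<^sub>R y + r"
      by (simp add: r_def)
    have "blinfun_apply g' y = blinfun_apply X (blinfun_apply g' x)"
      using op_exp_commute[of "- t" X] unfolding blinfun_eq_iff g'_def y_def by simp
    then have gy: "blinfun_apply g' y = cos t *\<^sub>R y + sin t *\<^sub>R x + s"
      unfolding gx s_def by (simp add: blinfun.bilinear_simps y_def algebra_simps)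
    have W: "blinfun_apply W w = blinfun_apply v (blinfun_apply g' w)" for w
      by (simp add: v_def inv)
    have vle: "inner (blinfun_apply v w) w' \<le> norm w * norm w'" for w w'
      using norm_cauchy_schwarz[of "blinfun_apply v w" w'] unitary_pairD(7)[OF v] by simp
    have "inner (blinfun_apply W x) x + inner (blinfun_apply W y) y =
        cos t * (inner (blinfun_apply v x) x + inner (blinfun_apply v y) y)
        + sin t * (inner (blinfun_apply v x) y - inner (blinfun_apply v y) x)
        + (inner (blinfun_apply v r) x + inner (blinfun_apply v s) y)"
      unfolding W gx gy by (simp add: blinfun.bilinear_simps inner_simps algebra_simps)
    also have "inner (blinfun_apply v x) y - inner (blinfun_apply v y) x = 2 * inner y (blinfun_apply A x)"
      using unitary_pairD(5)[OF v, of y x]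
      by (simp add: A_def blinfun.bilinear_simps inner_simps inner_commute)
    also have "sin t * (2 * inner y (blinfun_apply A x)) \<le> 2 * (\<eta> + 5 * e)"
    proof -
      have "sin t * inner y (blinfun_apply A x) =
          - inner y (blinfun_apply (- sin t *\<^sub>R Z) x) + sin t * inner y (blinfun_apply Y x)"
        by (simp add: Z_def blinfun.bilinear_simps inner_simps algebra_simps)
      moreover have "sin t * inner y (blinfun_apply Y x) \<le> 5 * e"
      proof -
        have "\<bar>inner y (blinfun_apply Y x)\<bar> \<le> 1 * (5 * e)"
          using Cauchy_Schwarz_ineq2[of y "blinfun_apply Y x"] norm_blinfun[of Y x] x(1) Y(3)
          by (intro order_trans[OF Cauchy_Schwarz_ineq2] mult_mono ny) auto
        then have "\<bar>sin t\<bar> * \<bar>inner y (blinfun_apply Y x)\<bar> \<le> 1 * (5 * e)"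
          by (intro mult_mono) auto
        then show ?thesis by (simp add: abs_mult[symmetric])
      qed
      ultimately show ?thesis using x(3) by (simp add: y_def)
    qed
    also have "cos t * (inner (blinfun_apply v x) x + inner (blinfun_apply v y) y) \<le> cos t * (1 + (norm y)\<^sup>2)"
      using vle[of x x] vle[of y y] x(1) cost by (intro mult_left_mono) (auto simp: power2_eq_square)
    also have "inner (blinfun_apply v r) x + inner (blinfun_apply v s) y \<le> \<eta> * \<bar>t\<bar> + (\<eta> * \<bar>t\<bar> + \<eta>)"
    proof (rule add_mono)
      show "inner (blinfun_apply v r) x \<le> \<eta> * \<bar>t\<bar>" using vle[of r x] r x(1) by simp
      show "inner (blinfun_apply v s) y \<le> \<eta> * \<bar>t\<bar> + \<eta>"
        using vle[of s y] mult_mono[OF s ny] eta by simp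
    qed
    finally have "cos L * 1 + cos L * (norm y)\<^sup>2 \<le> cos t * (1 + (norm y)\<^sup>2) + 2 * (\<eta> + 5 * e) + (\<eta> * \<bar>t\<bar> + (\<eta> * \<bar>t\<bar> + \<eta>))"
      using angle[of x] angle[of y] x(1) by simp
    then have *: "(cos L - cos t) * (1 + (norm y)\<^sup>2) \<le> 10 * e + (3 + 2 * \<bar>t\<bar>) * \<eta>"
      by (simp add: algebra_simps)
    \<comment> \<open>\<open>1 + \<parallel>y\<parallel>\<^sup>2 \<ge> 1\<close> suffices to drop this factor when the difference is nonnegative\<close>
    show ?thesis
    proof (cases "cos L - cos t \<ge> 0")
      case True
      then have "(cos L - cos t) * 1 \<le> (cos L - cos t) * (1 + (norm y)\<^sup>2)"
        by (intro mult_left_mono) auto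
      with * show ?thesis by simp
    next
      case False
      have "0 \<le> e" using U(4) norm_ge_zero order_trans by blast
      then have "0 \<le> 10 * e + (3 + 2 * \<bar>t\<bar>) * \<eta>" using eta by simp
      then show ?thesis using False by simp
    qed
  qed
  show ?thesis
  proof (rule field_le_epsilon)
    fix r :: real assume "r > 0"
    have "3 + 2 * \<bar>t\<bar> > 0" by (simp add: add_pos_nonneg)
    then show "cos L \<le> cos t + 10 * e + r"
      using main[of "r / (3 + 2 * \<bar>t\<bar>)"] \<open>r > 0\<close> by simp
  qed
qed

theorem theorem4p6:
  fixes P0 :: "'a::complex_hilbert \<Rightarrow>\<^sub>L 'a" and f0 :: 'a
    and V :: "('a \<Rightarrow>\<^sub>L 'a) \<times> 'a" and X0 :: "'a \<Rightarrow>\<^sub>L 'a"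
  assumes "(P0, f0) \<in> R_space"
    and "V \<in> tangent_space (P0, f0)"
    and "quotient_norm (P0, f0) V = 1"
    and "minimal_lifting (P0, f0) V X0"
  shows "\<forall>t::real. \<bar>t\<bar> \<le> pi / 2 \<longrightarrow>
    (\<forall>(a::real) (b::real) \<gamma> :: real \<Rightarrow> ('a \<Rightarrow>\<^sub>L 'a) \<times> 'a.
      a < b \<and> piecewise_smooth a b \<gamma> \<and> (\<forall>s\<in>{a..b}. \<gamma> s \<in> R_space) \<and>
      \<gamma> a = (P0, f0) \<and> \<gamma> b = exp_curve X0 (P0, f0) t \<longrightarrow>
      curve_length (min 0 t) (max 0 t) (exp_curve X0 (P0, f0)) \<le> curve_length a b \<gamma>)"
proof (intro allI impI, elim conjE)
  fix t a b :: real and \<gamma> :: "real \<Rightarrow> ('a \<Rightarrow>\<^sub>L 'a) \<times> 'a"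
  assume t: "\<bar>t\<bar> \<le> pi / 2" and ab: "a < b" and smooth: "piecewise_smooth a b \<gamma>"
    and R: "\<forall>s\<in>{a..b}. \<gamma> s \<in> R_space"
    and ends: "\<gamma> a = (P0, f0)" "\<gamma> b = exp_curve X0 (P0, f0) t"
  have X0: "X0 \<in> antihermitian_ops" "delta_map (P0, f0) X0 = V" "norm X0 = 1"
    using assms(3,4) by (auto simp: minimal_lifting_def liftings_def)
  have min: "1 \<le> norm Y" if "Y \<in> antihermitian_ops" "delta_map (P0, f0) Y = delta_map (P0, f0) X0" for Y
    using quotient_norm_le[OF that] X0(2) assms(3) by simp
  let ?L = "curve_length a b \<gamma>"
  have joined: "joined_upto (P0, f0) (exp_curve X0 (P0, f0) t) (?L + e) e" if "e > 0" for e
    using joined_upto_curve_length[OF ab smooth, of "e / (b - a)"] R ab that by (simp add: ends)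
  have "\<bar>t\<bar> \<le> ?L"
  proof (rule ccontr)
    assume less: "\<not> \<bar>t\<bar> \<le> ?L"
    have "0 \<le> ?L + e" if e: "e > 0" for e
    proof -
      obtain U W :: "'a \<Rightarrow>\<^sub>L 'a" where U: "unitary_pair U W"
        "\<And>x. norm x = 1 \<Longrightarrow> arccos (inner (blinfun_apply U x) x) \<le> ?L + e"
        using joined[OF e] unfolding joined_upto_def by blast
      have f0: "norm f0 = 1" using R_spaceD(8)[OF assms(1)] .
      have "\<bar>inner (blinfun_apply U f0) f0\<bar> \<le> 1"
        using Cauchy_Schwarz_ineq2[of "blinfun_apply U f0" f0] unitary_pairD(7)[OF U(1)] f0 by simp
      then have "0 \<le> arccos (inner (blinfun_apply U f0) f0)"
        by (intro arccos_lbound) auto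
      with U(2)[OF f0] show ?thesis by simp
    qed
    then have L0: "0 \<le> ?L" by (rule field_le_epsilon)
    have "cos ?L \<le> cos t"
    proof (rule tendsto_le[of "at_right 0"])
      show "((\<lambda>e. cos (?L + e)) \<longlongrightarrow> cos ?L) (at_right 0)"
        by (rule tendsto_eq_intros refl | simp)+
      show "((\<lambda>e. cos t + 10 * e) \<longlongrightarrow> cos t) (at_right 0)"
        by (rule tendsto_eq_intros refl | simp)+
      have "\<forall>\<^sub>F e in at_right 0. e \<in> {0<..<pi - ?L}"
        using less t pi_gt_zero by (intro eventually_at_right_real) linarith
      then show "\<forall>\<^sub>F e in at_right 0. cos (?L + e) \<le> cos t + 10 * e"
      proof eventually_elim
        case (elim e)
        then show ?case
          using joined_upto_exp_curve_bound[OF assms(1) X0(1,3) min t joined] by simp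
      qed
    qed simp
    moreover have "cos \<bar>t\<bar> < cos ?L"
      using less t L0 pi_gt_zero by (intro cos_monotone_0_pi) auto
    ultimately show False by simp
  qed
  then show "curve_length (min 0 t) (max 0 t) (exp_curve X0 (P0, f0)) \<le> ?L"
    using curve_length_exp_curve_le[of X0 t "(P0, f0)"] X0 by simp
qed

end
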